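(* Let $\Omega\subset\mathbb{H}$ be a symmetric slice domain, $I_0\in\mathbb{S}$, $h=h_{0}+h_{1}I_{0}\in\mathcal{S}_{I_0}(\Omega)\setminus\mathcal{S}_{\mathbb{R}}(\Omega)$ with $h_0,h_1\in\mathcal{S}_{\mathbb{R}}(\Omega)$, and $f\in \mathcal{S}(\Omega)\setminus\mathcal{S}_{I_0}(\Omega)$ with real part $f_0$. Let $M_0\in\mathbb{S}$. Then $h*f*h^c\in\mathcal{S}_{M_0}(\Omega)$ if and only if one of the following holds: (i) $I_0\perp M_0$ and, setting $K_0=I_0M_0$, there exists $\rho\in\mathcal{S}_{\mathbb{R}}(\Omega)$ such that $(h^s)^2\mid\rho(h_0^2-h_1^2)$, $(h^s)^2\mid\rho h_0h_1$ and $$f=f_0+ \frac{\rho(h_0^2-h_1^2)}{(h^s)^2}M_0-2\frac{\rho h_0h_1}{(h^s)^2}K_0;$$ (ii) $\mathbb{C}_{I_{0}}\neq \mathbb{C}_{M_{0}}$, $I_{0}\not\perp M_{0}$ and, with $K_0=\frac{I_0\wedge M_0}{|I_0\wedge M_0|}$, $J_0=K_0I_0$ and $M_0=aI_0+bJ_0$ (where $b>0$, $a^2+b^2=1$), there exists $\rho\in\mathcal{S}_{\mathbb{R}}(\Omega)$ such that $h^s\mid\rho(h_0^2-h_1^2)$, $h^s\mid h_0h_1\rho$ and $$f=f_0+a \rho I_0+ \frac{ b \rho(h_0^2-h_1^2)}{h^s}J_0-2\frac{b\rho h_0h_1 }{h^s}K_0.$$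
   Context: $\mathbb{H}$ is the algebra of quaternions with standard basis $1,i,j,k$, $\mathrm{Im}\,\mathbb{H}=\mathrm{Span}_{\mathbb{R}}(i,j,k)\simeq\mathbb{R}^3$ (Euclidean, with cross product $\wedge$), $\mathbb{S}=\{q\in\mathbb{H}: q^2=-1\}\subset\mathrm{Im}\,\mathbb{H}$, and $\mathbb{C}_I=\mathrm{Span}_{\mathbb{R}}(1,I)$ for $I\in\mathbb{S}$. A symmetric slice domain $\Omega\subset\mathbb{H}$ is a domain (connected open set) such that $\Omega\cap\mathbb{R}\neq\emptyset$ and, whenever $\alpha+I\beta\in\Omega$ ($\alpha,\beta\in\mathbb{R}$, $I\in\mathbb{S}$), also $\alpha+J\beta\in\Omega$ for all $J\in\mathbb{S}$. A function $f:\Omega\to\mathbb{H}$ is slice regular if for every $J\in\mathbb{S}$ the restriction $f_J$ of $f$ to $\Omega\cap\mathbb{C}_J$ is holomorphic: $\frac12\left(\frac{\partial}{\partial\alpha}+J\frac{\partial}{\partial\beta}\right)f_J(\alpha+J\beta)\equiv0$. $\mathcal{S}(\Omega)$ is the set of slice regular functions on $\Omega$; $\mathcal{S}_{\mathbb{R}}(\Omega)$ is the subset of slice preserving functions, i.e. $f(\Omega\cap\mathbb{C}_I)\subset\mathbb{C}_I$ for all $I\in\mathbb{S}$; $\mathcal{S}_{J}(\Omega)$ is the set of $f\in\mathcal{S}(\Omega)$ with $f(\Omega\cap\mathbb{C}_J)\subset\mathbb{C}_J$. Known facts: every $f\in\mathcal{S}(\Omega)$ is written uniquely as $f=f_0+f_1i+f_2j+f_3k$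 with $f_0,\dots,f_3\in\mathcal{S}_{\mathbb{R}}(\Omega)$ ($f_0$ is the real part); every $h\in\mathcal{S}_{I_0}(\Omega)$ is uniquely $h=h_0+h_1I_0$ with $h_0,h_1\in\mathcal{S}_{\mathbb{R}}(\Omega)$. The regular conjugate is $f^c=f_0-f_1i-f_2j-f_3k$; the $*$-product is $f*g=f_0g_0-f_1g_1-f_2g_2-f_3g_3+f_0(g_1i+g_2j+g_3k)+g_0(f_1i+f_2j+f_3k)+(f_2g_3-f_3g_2)i+(f_3g_1-f_1g_3)j+(f_1g_2-f_2g_1)k$ (pointwise products); it is associative. The symmetrized function is $h^s=h*h^c$, which equals $h_0^2+h_1^2$ for $h=h_0+h_1I_0$. For $\sigma,\tau\in\mathcal{S}_{\mathbb{R}}(\Omega)$, $\sigma\mid\tau$ means $\tau=\sigma\kappa$ for some $\kappa\in\mathcal{S}_{\mathbb{R}}(\Omega)$, and (for $\sigma\not\equiv0$) $\tau/\sigma$ denotes this $\kappa$. *)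

theory Defs
  imports "HOL-Analysis.Analysis"
begin

section \<open>Quaternions\<close>

datatype quat = Quat (qre: real) (qim1: real) (qim2: real) (qim3: real)

lemma quat_eq_iff:
  "p = q \<longleftrightarrow> qre p = qre q \<and> qim1 p = qim1 q \<and> qim2 p = qim2 q \<and> qim3 p = qim3 q"
  by (cases p; cases q) simp

instantiation quat :: ring_1
begin

definition zero_quat :: quat where "0 = Quat 0 0 0 0"

definition one_quat :: quat where "1 = Quat 1 0 0 0"

definition plus_quat :: "quat \<Rightarrow> quat \<Rightarrow> quat" where
  "p + q = Quat (qre p + qre q) (qim1 p + qim1 q) (qim2 p + qim2 q) (qim3 p + qim3 q)"

definition uminus_quat :: "quat \<Rightarrow> quat" where
  "- p = Quat (- qre p) (- qim1 p) (- qim2 p) (- qim3 p)"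

definition minus_quat :: "quat \<Rightarrow> quat \<Rightarrow> quat" where
  "p - q = Quat (qre p - qre q) (qim1 p - qim1 q) (qim2 p - qim2 q) (qim3 p - qim3 q)"

definition times_quat :: "quat \<Rightarrow> quat \<Rightarrow> quat" where
  "p * q = Quat
     (qre p * qre q - qim1 p * qim1 q - qim2 p * qim2 q - qim3 p * qim3 q)
     (qre p * qim1 q + qim1 p * qre q + qim2 p * qim3 q - qim3 p * qim2 q)
     (qre p * qim2 q - qim1 p * qim3 q + qim2 p * qre q + qim3 p * qim1 q)
     (qre p * qim3 q + qim1 p * qim2 q - qim2 p * qim1 q + qim3 p * qre q)"

instance
  by standard
    (simp_all add: quat_eq_iff zero_quat_def one_quat_def plus_quat_def uminus_quat_def
      minus_quat_def times_quat_def algebra_simps)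

end

lemma quat_sel_simps [simp]:
  "qre 0 = 0" "qim1 0 = 0" "qim2 0 = 0" "qim3 0 = 0"
  "qre 1 = 1" "qim1 1 = 0" "qim2 1 = 0" "qim3 1 = 0"
  "qre (p + q) = qre p + qre q" "qim1 (p + q) = qim1 p + qim1 q"
  "qim2 (p + q) = qim2 p + qim2 q" "qim3 (p + q) = qim3 p + qim3 q"
  "qre (- p) = - qre p" "qim1 (- p) = - qim1 p" "qim2 (- p) = - qim2 p" "qim3 (- p) = - qim3 p"
  "qre (p - q) = qre p - qre q" "qim1 (p - q) = qim1 p - qim1 q"
  "qim2 (p - q) = qim2 p - qim2 q" "qim3 (p - q) = qim3 p - qim3 q"
  by (simp_all add: zero_quat_def one_quat_def plus_quat_def uminus_quat_def minus_quat_def)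

lemma quat_sel_times [simp]:
  "qre (p * q) = qre p * qre q - qim1 p * qim1 q - qim2 p * qim2 q - qim3 p * qim3 q"
  "qim1 (p * q) = qre p * qim1 q + qim1 p * qre q + qim2 p * qim3 q - qim3 p * qim2 q"
  "qim2 (p * q) = qre p * qim2 q - qim1 p * qim3 q + qim2 p * qre q + qim3 p * qim1 q"
  "qim3 (p * q) = qre p * qim3 q + qim1 p * qim2 q - qim2 p * qim1 q + qim3 p * qre q"
  by (simp_all add: times_quat_def)

instantiation quat :: real_algebra_1
begin

definition scaleR_quat :: "real \<Rightarrow> quat \<Rightarrow> quat" where
  "r *\<^sub>R p = Quat (r * qre p) (r * qim1 p) (r * qim2 p) (r * qim3 p)"

instance
  by standard (simp_all add: quat_eq_iff scaleR_quat_def algebra_simps)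

end

lemma quat_sel_scaleR [simp]:
  "qre (r *\<^sub>R p) = r * qre p" "qim1 (r *\<^sub>R p) = r * qim1 p"
  "qim2 (r *\<^sub>R p) = r * qim2 p" "qim3 (r *\<^sub>R p) = r * qim3 p"
  by (simp_all add: scaleR_quat_def)

lemma quat_sel_of_real [simp]:
  "qre (of_real r) = r" "qim1 (of_real r) = 0" "qim2 (of_real r) = 0" "qim3 (of_real r) = 0"
  by (simp_all add: of_real_def)

lemma quat_norm_pos:
  assumes "p \<noteq> 0"
  shows "(qre p)\<^sup>2 + (qim1 p)\<^sup>2 + (qim2 p)\<^sup>2 + (qim3 p)\<^sup>2 > 0"
proof -
  have "qre p \<noteq> 0 \<or> qim1 p \<noteq> 0 \<or> qim2 p \<noteq> 0 \<or> qim3 p \<noteq> 0"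
    using assms by (auto simp: quat_eq_iff)
  then have "(qre p)\<^sup>2 > 0 \<or> (qim1 p)\<^sup>2 > 0 \<or> (qim2 p)\<^sup>2 > 0 \<or> (qim3 p)\<^sup>2 > 0"
    by simp
  then show ?thesis
    using zero_le_power2[of "qre p"] zero_le_power2[of "qim1 p"]
      zero_le_power2[of "qim2 p"] zero_le_power2[of "qim3 p"] by linarith
qed

instantiation quat :: division_ring
begin

definition inverse_quat :: "quat \<Rightarrow> quat" where
  "inverse p = (1 / ((qre p)\<^sup>2 + (qim1 p)\<^sup>2 + (qim2 p)\<^sup>2 + (qim3 p)\<^sup>2)) *\<^sub>R
     Quat (qre p) (- qim1 p) (- qim2 p) (- qim3 p)"

definition divide_quat :: "quat \<Rightarrow> quat \<Rightarrow> quat" where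
  "p div (q::quat) = p * inverse q"

instance
proof
  fix p q :: quat
  let ?c = "Quat (qre p) (- qim1 p) (- qim2 p) (- qim3 p)"
  let ?N = "(qre p)\<^sup>2 + (qim1 p)\<^sup>2 + (qim2 p)\<^sup>2 + (qim3 p)\<^sup>2"
  have "?c * p = ?N *\<^sub>R 1" "p * ?c = ?N *\<^sub>R 1"
    by (simp_all add: quat_eq_iff power2_eq_square)
  moreover have "?N \<noteq> 0" if "p \<noteq> 0"
    using quat_norm_pos[OF that] by simp
  ultimately show "inverse p * p = 1" "p * inverse p = 1" if "p \<noteq> 0"
    using that by (simp_all add: inverse_quat_def)
  show "p div q = p * inverse q"
    by (simp add: divide_quat_def)
  show "inverse (0::quat) = 0"
    by (simp add: quat_eq_iff inverse_quat_def)
qed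

end

instantiation quat :: real_inner
begin

definition inner_quat :: "quat \<Rightarrow> quat \<Rightarrow> real" where
  "p \<bullet> q = qre p * qre q + qim1 p * qim1 q + qim2 p * qim2 q + qim3 p * qim3 q"

definition norm_quat :: "quat \<Rightarrow> real" where
  "norm (p::quat) = sqrt (p \<bullet> p)"

definition sgn_quat :: "quat \<Rightarrow> quat" where
  "sgn (p::quat) = p /\<^sub>R norm p"

definition dist_quat :: "quat \<Rightarrow> quat \<Rightarrow> real" where
  "dist (p::quat) q = norm (p - q)"

definition uniformity_quat :: "(quat \<times> quat) filter" where
  "uniformity = (INF e\<in>{0<..}. principal {(x::quat, y). dist x y < e})"

definition open_quat :: "quat set \<Rightarrow> bool" where
  "open (U::quat set) = (\<forall>x\<in>U. \<forall>\<^sub>F (x', y) in uniformity. x' = x \<longrightarrow> y \<in> U)"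

instance
proof
  fix p q s :: quat and r :: real and U :: "quat set"
  show "dist p q = norm (p - q)" by (rule dist_quat_def)
  show "sgn p = p /\<^sub>R norm p" by (rule sgn_quat_def)
  show "uniformity = (INF e\<in>{0<..}. principal {(x, y). dist (x::quat) y < e})"
    by (rule uniformity_quat_def)
  show "open U = (\<forall>x\<in>U. \<forall>\<^sub>F (x', y) in uniformity. x' = x \<longrightarrow> y \<in> U)"
    by (rule open_quat_def)
  show "p \<bullet> q = q \<bullet> p" by (simp add: inner_quat_def algebra_simps)
  show "(p + q) \<bullet> s = p \<bullet> s + q \<bullet> s" by (simp add: inner_quat_def algebra_simps)
  show "(r *\<^sub>R p) \<bullet> q = r * (p \<bullet> q)" by (simp add: inner_quat_def algebra_simps)
  show "0 \<le> p \<bullet> p" by (simp add: inner_quat_def)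
  show "p \<bullet> p = 0 \<longleftrightarrow> p = 0"
  proof (cases "p = 0")
    case False
    then show ?thesis
      using quat_norm_pos[OF False] by (simp add: inner_quat_def power2_eq_square)
  qed (simp add: inner_quat_def)
  show "norm p = sqrt (p \<bullet> p)" by (rule norm_quat_def)
qed

end

instance quat :: real_normed_div_algebra
proof
  fix p q :: quat
  have "(p * q) \<bullet> (p * q) = (p \<bullet> p) * (q \<bullet> q)"
    unfolding inner_quat_def quat_sel_times by algebra
  then show "norm (p * q) = norm p * norm q"
    by (simp add: norm_quat_def real_sqrt_mult)
qed

definition quat_i :: quat where "quat_i = Quat 0 1 0 0"
definition quat_j :: quat where "quat_j = Quat 0 0 1 0"
definition quat_k :: quat where "quat_k = Quat 0 0 0 1"

lemma quat_sel_units [simp]: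
  "qre quat_i = 0" "qim1 quat_i = 1" "qim2 quat_i = 0" "qim3 quat_i = 0"
  "qre quat_j = 0" "qim1 quat_j = 0" "qim2 quat_j = 1" "qim3 quat_j = 0"
  "qre quat_k = 0" "qim1 quat_k = 0" "qim2 quat_k = 0" "qim3 quat_k = 1"
  by (simp_all add: quat_i_def quat_j_def quat_k_def)

instantiation quat :: euclidean_space
begin

definition Basis_quat :: "quat set" where
  "Basis = {1, quat_i, quat_j, quat_k}"

instance
proof
  show "(Basis :: quat set) \<noteq> {}" and "finite (Basis :: quat set)"
    by (simp_all add: Basis_quat_def)
  show "u \<bullet> v = (if u = v then 1 else 0)" if "u \<in> Basis" "v \<in> Basis" for u v :: quat
    using that unfolding Basis_quat_def insert_iff empty_iff
    by (elim disjE) (simp_all add: inner_quat_def quat_eq_iff)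
  show "(\<forall>u\<in>Basis. x \<bullet> u = 0) \<longleftrightarrow> x = 0" for x :: quat
    by (simp add: Basis_quat_def inner_quat_def quat_eq_iff[of x])
qed

end

text \<open>The identification of the imaginary quaternions with three-dimensional Euclidean space;
  \<open>quat_vec\<close> is only meant for imaginary arguments.\<close>

definition quat_vec :: "quat \<Rightarrow> real ^ 3" where
  "quat_vec q = vector [qim1 q, qim2 q, qim3 q]"

definition vec_quat :: "real ^ 3 \<Rightarrow> quat" where
  "vec_quat v = Quat 0 (v $ 1) (v $ 2) (v $ 3)"

definition quat_wedge :: "quat \<Rightarrow> quat \<Rightarrow> quat" where
  "quat_wedge p q = vec_quat (cross3 (quat_vec p) (quat_vec q))"

definition imag_units :: "quat set" where
  "imag_units = {q. q\<^sup>2 = - 1}"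

definition slice_plane :: "quat \<Rightarrow> quat set" where
  "slice_plane I = span {1, I}"


section \<open>Slice regular functions\<close>

text \<open>A function on \<open>\<Omega>\<close> is represented by a total function of which only the values on \<open>\<Omega>\<close>
  matter; equality of functions is always equality on \<open>\<Omega>\<close>.\<close>

definition symmetric_slice_domain :: "quat set \<Rightarrow> bool" where
  "symmetric_slice_domain \<Omega> \<longleftrightarrow>
     open \<Omega> \<and> connected \<Omega> \<and> \<Omega> \<inter> \<real> \<noteq> {} \<and>
     (\<forall>\<alpha> \<beta>. \<forall>I\<in>imag_units. \<forall>J\<in>imag_units.
        of_real \<alpha> + I * of_real \<beta> \<in> \<Omega> \<longrightarrow> of_real \<alpha> + J * of_real \<beta> \<in> \<Omega>)"

text \<open>Holomorphy of the restriction to a slice: real (Frechet) differentiability in the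
  coordinates \<open>(\<alpha>, \<beta>)\<close> together with the Cauchy-Riemann equation. The partial derivatives are
  the values of the total derivative at the two unit vectors. The operator acts from the left,
  and \<open>J\<close> does not commute with the values of \<open>f\<close> in general.\<close>

definition slice_holomorphic :: "quat set \<Rightarrow> quat \<Rightarrow> (quat \<Rightarrow> quat) \<Rightarrow> bool" where
  "slice_holomorphic \<Omega> J f \<longleftrightarrow>
     (\<forall>\<alpha> \<beta>. of_real \<alpha> + J * of_real \<beta> \<in> \<Omega> \<longrightarrow>
        (\<exists>D. ((\<lambda>(x, y). f (of_real x + J * of_real y)) has_derivative D) (at (\<alpha>, \<beta>)) \<and>
             (1 / 2) *\<^sub>R (D (1, 0) + J * D (0, 1)) = 0))"

definition slice_regular :: "quat set \<Rightarrow> (quat \<Rightarrow> quat) set" where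
  "slice_regular \<Omega> = {f. \<forall>J\<in>imag_units. slice_holomorphic \<Omega> J f}"

definition slice_preserving :: "quat set \<Rightarrow> (quat \<Rightarrow> quat) set" where
  "slice_preserving \<Omega> =
     {f \<in> slice_regular \<Omega>. \<forall>I\<in>imag_units. f ` (\<Omega> \<inter> slice_plane I) \<subseteq> slice_plane I}"

definition slice_regular_on :: "quat set \<Rightarrow> quat \<Rightarrow> (quat \<Rightarrow> quat) set" where
  "slice_regular_on \<Omega> J = {f \<in> slice_regular \<Omega>. f ` (\<Omega> \<inter> slice_plane J) \<subseteq> slice_plane J}"

text \<open>The decomposition \<open>f = f\<^sub>0 + f\<^sub>1 i + f\<^sub>2 j + f\<^sub>3 k\<close> with slice preserving components. For a
  slice regular \<open>f\<close> on a symmetric slice domain it exists and the components are unique on \<open>\<Omega>\<close>,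
  so the choice operator below only leaves the irrelevant values outside \<open>\<Omega>\<close> open.\<close>

definition is_slice_decomp ::
  "quat set \<Rightarrow> (quat \<Rightarrow> quat) \<Rightarrow>
    (quat \<Rightarrow> quat) \<times> (quat \<Rightarrow> quat) \<times> (quat \<Rightarrow> quat) \<times> (quat \<Rightarrow> quat) \<Rightarrow> bool" where
  "is_slice_decomp \<Omega> f = (\<lambda>(f0, f1, f2, f3).
     f0 \<in> slice_preserving \<Omega> \<and> f1 \<in> slice_preserving \<Omega> \<and>
     f2 \<in> slice_preserving \<Omega> \<and> f3 \<in> slice_preserving \<Omega> \<and>
     (\<forall>q\<in>\<Omega>. f q = f0 q + f1 q * quat_i + f2 q * quat_j + f3 q * quat_k))"

definition slice_decomp ::
  "quat set \<Rightarrow> (quat \<Rightarrow> quat) \<Rightarrow>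
    (quat \<Rightarrow> quat) \<times> (quat \<Rightarrow> quat) \<times> (quat \<Rightarrow> quat) \<times> (quat \<Rightarrow> quat)" where
  "slice_decomp \<Omega> f = (SOME c. is_slice_decomp \<Omega> f c)"

definition slice_real_part :: "quat set \<Rightarrow> (quat \<Rightarrow> quat) \<Rightarrow> quat \<Rightarrow> quat" where
  "slice_real_part \<Omega> f = fst (slice_decomp \<Omega> f)"

definition regular_conj :: "quat set \<Rightarrow> (quat \<Rightarrow> quat) \<Rightarrow> quat \<Rightarrow> quat" where
  "regular_conj \<Omega> f =
     (case slice_decomp \<Omega> f of (f0, f1, f2, f3) \<Rightarrow>
        (\<lambda>q. f0 q - f1 q * quat_i - f2 q * quat_j - f3 q * quat_k))"

definition star_prod :: "quat set \<Rightarrow> (quat \<Rightarrow> quat) \<Rightarrow> (quat \<Rightarrow> quat) \<Rightarrow> quat \<Rightarrow> quat" where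
  "star_prod \<Omega> f g =
     (case slice_decomp \<Omega> f of (f0, f1, f2, f3) \<Rightarrow>
      case slice_decomp \<Omega> g of (g0, g1, g2, g3) \<Rightarrow>
        (\<lambda>q. f0 q * g0 q - f1 q * g1 q - f2 q * g2 q - f3 q * g3 q
          + f0 q * (g1 q * quat_i + g2 q * quat_j + g3 q * quat_k)
          + g0 q * (f1 q * quat_i + f2 q * quat_j + f3 q * quat_k)
          + (f2 q * g3 q - f3 q * g2 q) * quat_i
          + (f3 q * g1 q - f1 q * g3 q) * quat_j
          + (f1 q * g2 q - f2 q * g1 q) * quat_k))"

definition symmetrized :: "quat set \<Rightarrow> (quat \<Rightarrow> quat) \<Rightarrow> quat \<Rightarrow> quat" where
  "symmetrized \<Omega> h = star_prod \<Omega> h (regular_conj \<Omega> h)"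

definition is_slice_quot ::
  "quat set \<Rightarrow> (quat \<Rightarrow> quat) \<Rightarrow> (quat \<Rightarrow> quat) \<Rightarrow> (quat \<Rightarrow> quat) \<Rightarrow> bool" where
  "is_slice_quot \<Omega> \<tau> \<sigma> \<kappa> \<longleftrightarrow> \<kappa> \<in> slice_preserving \<Omega> \<and> (\<forall>q\<in>\<Omega>. \<tau> q = \<sigma> q * \<kappa> q)"

definition slice_dvd :: "quat set \<Rightarrow> (quat \<Rightarrow> quat) \<Rightarrow> (quat \<Rightarrow> quat) \<Rightarrow> bool" where
  "slice_dvd \<Omega> \<sigma> \<tau> \<longleftrightarrow> (\<exists>\<kappa>. is_slice_quot \<Omega> \<tau> \<sigma> \<kappa>)"

text \<open>The quotient \<open>\<tau> / \<sigma>\<close>. It is not the pointwise quotient, which would be \<open>0\<close> at the zeros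
  of \<open>\<sigma>\<close>. If \<open>\<sigma>\<close> divides \<open>\<tau>\<close> and does not vanish identically, it is unique on \<open>\<Omega>\<close>.\<close>

definition slice_quot ::
  "quat set \<Rightarrow> (quat \<Rightarrow> quat) \<Rightarrow> (quat \<Rightarrow> quat) \<Rightarrow> quat \<Rightarrow> quat" where
  "slice_quot \<Omega> \<tau> \<sigma> = (SOME \<kappa>. is_slice_quot \<Omega> \<tau> \<sigma> \<kappa>)"

end

theory Submission
  imports Defs "HOL-Complex_Analysis.Complex_Analysis"
begin

text \<open>By the identity principle a slice regular function is determined by its values on
  \<open>\<Omega> \<inter> \<real>\<close>. There the \<open>*\<close>-product is the product of quaternions, the regular conjugate is the
  quaternionic conjugate, slice preserving functions are the real valued ones, and membership in
  \<open>S\<^sub>M(\<Omega>)\<close> means having values in \<open>\<complex>\<^sub>M\<close>. In an orthonormal frame \<open>I\<close>, \<open>J\<close>, \<open>K = I J\<close> with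
  \<open>M\<^sub>0 = a I + b J\<close>, the condition on \<open>h * f * h\<^sup>c\<close> becomes two linear equations for the components of \<open>f\<close>,
  since conjugation by \<open>h\<^sub>0 + h\<^sub>1 I\<close> scales the \<open>I\<close>-axis by \<open>h\<^sub>0\<^sup>2 + h\<^sub>1\<^sup>2\<close> and multiplies the
  \<open>J\<close>-\<open>K\<close>-plane by \<open>(h\<^sub>0 + h\<^sub>1 I)\<^sup>2\<close>. Solving them is linear algebra over the slice preserving
  functions, which have no zero divisors.\<close>

section \<open>Slices and the identity principle\<close>

text \<open>The powers of h^s in (i) and (ii) come from conjugating back. Since h^c * h = h^s is
  central, g = h * f * h^c gives (h^s)^2 f = h^c * g * h, and on the J-K plane this is
  multiplication by (h0 - h1 I0)^2 = h0^2 - h1^2 - 2 h0 h1 I0. In (i) the vector part of g is some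
  \<rho> M0, so both powers of h^s remain. In (ii) the I0-coordinate of f is written a \<rho>;
  conjugation scales it to a h^s \<rho>, the plane of M0 forces the J0-coordinate b h^s \<rho>, and
  one power of h^s cancels. If M0 is I0 or -I0, the J-K part of f has to vanish, which the
  hypothesis on f excludes. The obstacle is that h^s may have zeros, even real ones, so quotients
  cannot be taken pointwise. On the real axis h^s is h0^2 + h1^2 with real h0, h1; at its zeros h0 =
  h1 = 0 and the equations to be checked are trivial, elsewhere it may be cancelled. In the forward
  direction no division takes place at all: the quotients are real multiples of coordinates of
  f.\<close>

lemma imag_units_iff: "q \<in> imag_units \<longleftrightarrow> qre q = 0 \<and> norm q = 1"
proof
  assume "q \<in> imag_units"
  then have sq: "q * q = - 1"
    by (simp add: imag_units_def power2_eq_square)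
  have "qre (q * q) = - 1" "qim1 (q * q) = 0" "qim2 (q * q) = 0" "qim3 (q * q) = 0"
    unfolding sq by simp_all
  then have *: "qre q * qre q - qim1 q * qim1 q - qim2 q * qim2 q - qim3 q * qim3 q = - 1"
    "qre q * qim1 q = 0" "qre q * qim2 q = 0" "qre q * qim3 q = 0"
    by (simp_all add: algebra_simps)
  have "qre q = 0"
  proof (rule ccontr)
    assume "qre q \<noteq> 0"
    with * have "qre q * qre q = - 1" by simp
    then show False using zero_le_square[of "qre q"] by linarith
  qed
  with * show "qre q = 0 \<and> norm q = 1"
    by (simp add: norm_quat_def inner_quat_def)
next
  assume "qre q = 0 \<and> norm q = 1"
  then show "q \<in> imag_units"
    by (auto simp: imag_units_def power2_eq_square quat_eq_iff norm_quat_def inner_quat_def)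
qed

lemma imag_unit_square: "J \<in> imag_units \<Longrightarrow> J * J = - 1"
  by (simp add: imag_units_def power2_eq_square)

lemma quat_units_imag_units [simp]: "quat_i \<in> imag_units" "quat_j \<in> imag_units" "quat_k \<in> imag_units"
  by (simp_all add: imag_units_iff norm_quat_def inner_quat_def)

lemma imag_units_uminus: "J \<in> imag_units \<Longrightarrow> - J \<in> imag_units"
  by (simp add: imag_units_iff)

lemma quat_of_real_commute: "of_real r * (q :: quat) = q * of_real r"
  by (simp add: quat_eq_iff)

lemma slice_plane_iff: "q \<in> slice_plane J \<longleftrightarrow> (\<exists>x y. q = of_real x + J * of_real y)"
proof -
  have "q \<in> slice_plane J \<longleftrightarrow> (\<exists>x y. q = x *\<^sub>R 1 + y *\<^sub>R J)"
    unfolding slice_plane_def span_insert span_empty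
    by (force simp: algebra_simps)
  also have "\<dots> \<longleftrightarrow> (\<exists>x y. q = of_real x + J * of_real y)"
    by (simp add: scaleR_conv_of_real quat_of_real_commute)
  finally show ?thesis .
qed

lemma slice_plane_times:
  assumes "J \<in> imag_units" "p \<in> slice_plane J" "q \<in> slice_plane J"
  shows "p * q \<in> slice_plane J"
proof -
  obtain x y u v where "p = of_real x + J * of_real y" "q = of_real u + J * of_real v"
    using assms(2,3) unfolding slice_plane_iff by blast
  then have "p * q = x *\<^sub>R u *\<^sub>R 1 + (x * v) *\<^sub>R J + (y * u) *\<^sub>R J + (y * v) *\<^sub>R (J * J)"
    by (simp add: quat_eq_iff algebra_simps)
  then have "p * q = of_real (x * u - y * v) + J * of_real (x * v + y * u)"
    unfolding imag_unit_square[OF assms(1)] by (simp add: quat_eq_iff algebra_simps)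
  then show ?thesis
    unfolding slice_plane_iff by blast
qed

lemma slice_plane_commute:
  assumes "p \<in> slice_plane J"
  shows "p * J = J * p"
  using assms unfolding slice_plane_iff
  by (auto simp: distrib_left distrib_right quat_of_real_commute mult.assoc)

definition qim :: "quat \<Rightarrow> quat" where "qim q = q - of_real (qre q)"

lemma qim_sel [simp]: "qre (qim q) = 0" "qim1 (qim q) = qim1 q" "qim2 (qim q) = qim2 q" "qim3 (qim q) = qim3 q"
  by (simp_all add: qim_def)

section \<open>Polar form of quaternions and membership in slices\<close>

lemma quat_polar:
  obtains J where "J \<in> imag_units" "q = of_real (qre q) + J * of_real (norm (qim q))"
proof (cases "qim q = 0")
  case True
  have "q = of_real (qre q) + qim q" by (simp add: qim_def)
  with True show thesis using that[of quat_i] by simp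
next
  case False
  let ?J = "(1 / norm (qim q)) *\<^sub>R qim q"
  have "?J \<in> imag_units" using False by (simp add: imag_units_iff)
  moreover have "?J * of_real (norm (qim q)) = qim q"
    using False by (simp add: of_real_def)
  then have "q = of_real (qre q) + ?J * of_real (norm (qim q))"
    by (simp add: qim_def)
  ultimately show thesis using that by blast
qed

lemma qre_slice: "J \<in> imag_units \<Longrightarrow> qre (of_real x + J * of_real y) = x"
  by (simp add: imag_units_iff)

lemma qim_slice: "J \<in> imag_units \<Longrightarrow> qim (of_real x + J * of_real y) = J * of_real y"
  by (simp add: imag_units_iff qim_def)

lemma norm_qim_slice: "J \<in> imag_units \<Longrightarrow> norm (qim (of_real x + J * of_real y)) = \<bar>y\<bar>"
  by (simp add: qim_slice norm_mult) (simp add: imag_units_iff)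

lemma bounded_linear_quat_mult_slice:
  "bounded_linear (\<lambda>p :: real \<times> real. of_real (fst p) + (J :: quat) * of_real (snd p))"
  by (intro bounded_linear_add bounded_linear_const_mult
      bounded_linear_compose[OF bounded_linear_of_real] bounded_linear_fst bounded_linear_snd)

lemma slice_mem_iff:
  assumes "symmetric_slice_domain \<Omega>" "I \<in> imag_units" "J \<in> imag_units"
  shows "of_real x + I * of_real y \<in> \<Omega> \<longleftrightarrow> of_real x + J * of_real y \<in> \<Omega>"
  using assms unfolding symmetric_slice_domain_def by blast

lemma slice_mem_uminus_iff:
  assumes "symmetric_slice_domain \<Omega>" "J \<in> imag_units"
  shows "of_real x + J * of_real (- y) \<in> \<Omega> \<longleftrightarrow> of_real x + J * of_real y \<in> \<Omega>"
  using slice_mem_iff[OF assms(1) imag_units_uminus[OF assms(2)] assms(2), of x y] by simp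

lemma open_slice:
  assumes "open \<Omega>"
  shows "open {(x, y). of_real x + (J :: quat) * of_real y \<in> \<Omega>}"
proof -
  have "continuous_on UNIV (\<lambda>p :: real \<times> real. of_real (fst p) + J * of_real (snd p))"
    by (intro linear_continuous_on bounded_linear_quat_mult_slice)
  from open_vimage[OF assms this] show ?thesis
    by (simp add: vimage_def case_prod_beta')
qed

text \<open>Only the values on \<Omega> carry meaning, and a derivative at a point of a slice sees
  only a neighbourhood, which can be kept inside \<Omega> since the slice is open.\<close>

lemma slice_regular_cong:
  assumes "open \<Omega>" "\<And>q. q \<in> \<Omega> \<Longrightarrow> f q = g q" "f \<in> slice_regular \<Omega>"
  shows "g \<in> slice_regular \<Omega>"
  unfolding slice_regular_def slice_holomorphic_def
proof (safe)
  fix J :: quat and x y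
  assume J: "J \<in> imag_units" and m: "of_real x + J * of_real y \<in> \<Omega>"
  from J m assms(3) obtain D where
    D: "((\<lambda>(x, y). f (of_real x + J * of_real y)) has_derivative D) (at (x, y))"
    "(1 / 2) *\<^sub>R (D (1, 0) + J * D (0, 1)) = 0"
    unfolding slice_regular_def slice_holomorphic_def by blast
  have "((\<lambda>(x, y). g (of_real x + J * of_real y)) has_derivative D) (at (x, y))"
    by (rule has_derivative_transform_within_open[OF D(1) open_slice[OF assms(1), of J]])
      (use m assms(2) in auto)
  with D(2) show "\<exists>D. ((\<lambda>(x, y). g (of_real x + J * of_real y)) has_derivative D) (at (x, y)) \<and>
    (1 / 2) *\<^sub>R (D (1, 0) + J * D (0, 1)) = 0" by blast
qed

lemma slice_preserving_cong:
  assumes "open \<Omega>" "\<And>q. q \<in> \<Omega> \<Longrightarrow> f q = g q" "f \<in> slice_preserving \<Omega>"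
  shows "g \<in> slice_preserving \<Omega>"
  using slice_regular_cong[OF assms(1,2)] assms(2,3)
  unfolding slice_preserving_def by (auto simp: image_subset_iff)

text \<open>By symmetry the image of \<Omega> under q -> Re q + i |Im q| is the part of the slice
  with nonnegative imaginary coordinate, so that part is connected. The slice is its union with the
  mirror image, and the two meet at a real point of \<Omega>.\<close>

lemma connected_slice:
  assumes "symmetric_slice_domain \<Omega>" "J \<in> imag_units"
  shows "connected {z. of_real (Re z) + J * of_real (Im z) \<in> \<Omega>}" (is "connected ?D")
proof -
  have conn: "connected \<Omega>" using assms(1) by (simp add: symmetric_slice_domain_def)
  let ?P = "\<lambda>q. Complex (qre q) (norm (qim q))"
  have qre: "qre = (\<lambda>q. q \<bullet> 1)" by (auto simp: inner_quat_def)
  have cont: "continuous_on \<Omega> ?P"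
    unfolding Complex_eq qim_def qre by (intro continuous_intros)
  have c1: "connected (?P ` \<Omega>)" by (rule connected_continuous_image[OF cont conn])
  have c2: "connected (cnj ` ?P ` \<Omega>)" by (rule connected_continuous_image[OF _ c1]) (intro continuous_intros)
  obtain x0 where x0: "of_real x0 \<in> \<Omega>"
    using assms(1) unfolding symmetric_slice_domain_def by (auto elim!: Reals_cases)
  have "?P (of_real x0) = of_real x0" "cnj (?P (of_real x0)) = of_real x0"
    by (simp_all add: complex_eq_iff qim_def)
  then have "of_real x0 \<in> ?P ` \<Omega> \<inter> cnj ` ?P ` \<Omega>"
    using imageI[OF x0, of ?P] imageI[OF imageI[OF x0, of ?P], of cnj] by simp
  then have c: "connected (?P ` \<Omega> \<union> cnj ` ?P ` \<Omega>)"
    using connected_Un[OF c1 c2] by blast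
  have sub: "?P q \<in> ?D" if "q \<in> \<Omega>" for q
  proof -
    obtain I where I: "I \<in> imag_units" "q = of_real (qre q) + I * of_real (norm (qim q))"
      by (rule quat_polar)
    from that I(2) have "of_real (qre q) + I * of_real (norm (qim q)) \<in> \<Omega>" by metis
    then show ?thesis using slice_mem_iff[OF assms(1) I(1) assms(2)] by simp
  qed
  have sub2: "cnj z \<in> ?D" if "z \<in> ?D" for z
    using that slice_mem_uminus_iff[OF assms] by simp
  have "?D = ?P ` \<Omega> \<union> cnj ` ?P ` \<Omega>"
  proof (rule equalityI; rule subsetI)
    fix z assume z: "z \<in> ?D"
    then have m: "of_real (Re z) + J * of_real (Im z) \<in> \<Omega>" by simp
    have "?P (of_real (Re z) + J * of_real (Im z)) = Complex (Re z) \<bar>Im z\<bar>"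
      using assms(2) by (simp only: qre_slice norm_qim_slice)
    then have 1: "Complex (Re z) \<bar>Im z\<bar> \<in> ?P ` \<Omega>" using imageI[OF m, of ?P] by (simp only:)
    have "z = Complex (Re z) \<bar>Im z\<bar> \<or> z = cnj (Complex (Re z) \<bar>Im z\<bar>)"
      by (auto simp: complex_eq_iff)
    then show "z \<in> ?P ` \<Omega> \<union> cnj ` ?P ` \<Omega>"
      using 1 imageI[OF 1, of cnj] by (metis UnI1 UnI2)
  qed (use sub sub2 in blast)
  with c show ?thesis by simp
qed

text \<open>Left multiplication by J makes the quaternions a complex vector space, and the
  Cauchy-Riemann equation says that the derivative along the slice is complex linear for it. Each
  \<open>\<phi>\<close> is a complex linear functional, so composing with it yields an ordinary
  holomorphic function. The vector u stays free so that it can be chosen to detect a given value of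
  f.\<close>

lemma slice_coordinate_holomorphic:
  fixes u :: quat
  assumes "f \<in> slice_regular \<Omega>" "J \<in> imag_units"
  defines "\<phi> \<equiv> \<lambda>q. Complex (q \<bullet> u) (q \<bullet> (J * u))"
  shows "(\<lambda>z. \<phi> (f (of_real (Re z) + J * of_real (Im z)))) holomorphic_on
    {z. of_real (Re z) + J * of_real (Im z) \<in> \<Omega>}"
proof (rule holomorphic_onI)
  fix z assume "z \<in> {z. of_real (Re z) + J * of_real (Im z) \<in> \<Omega>}"
  then have "of_real (Re z) + J * of_real (Im z) \<in> \<Omega>" by simp
  then obtain D where
    D: "((\<lambda>(x, y). f (of_real x + J * of_real y)) has_derivative D) (at (Re z, Im z))"
    "(1 / 2) *\<^sub>R (D (1, 0) + J * D (0, 1)) = 0"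
    using assms(1,2) unfolding slice_regular_def slice_holomorphic_def by blast
  have bl: "bounded_linear \<phi>"
  proof -
    have "\<phi> = (\<lambda>q. of_real (q \<bullet> u) + \<i> * of_real (q \<bullet> (J * u)))"
      by (auto simp: \<phi>_def complex_eq_iff)
    then show ?thesis
      by (auto intro!: bounded_linear_add bounded_linear_const_mult
        bounded_linear_compose[OF bounded_linear_of_real] bounded_linear_inner_left)
  qed
  interpret \<phi>: bounded_linear \<phi> by (rule bl)
  interpret D: bounded_linear D using D(1) by (rule has_derivative_bounded_linear)
  have e: "D (0, 1) = J * D (1, 0)"
  proof -
    from D(2) have "D (1, 0) = - (J * D (0, 1))" by (simp add: add_eq_0_iff2)
    then have "J * D (1, 0) = - (J * J * D (0, 1))" by (simp add: mult.assoc)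
    then show ?thesis by (simp add: imag_unit_square[OF assms(2)])
  qed
  have J0: "qre J = 0" "qim1 J * qim1 J + qim2 J * qim2 J + qim3 J * qim3 J = 1"
    using assms(2) unfolding imag_units_iff by (auto simp: norm_quat_def inner_quat_def)
  \<comment> \<open>Left multiplication by an imaginary unit is skew-adjoint; this makes
    \<open>\<phi>\<close> complex linear.\<close>
  have JJ: "(J * q) \<bullet> p = - (q \<bullet> (J * p))" for p q
    by (simp add: inner_quat_def J0 algebra_simps)
  have "J * (J * u) = - u" by (simp add: imag_unit_square[OF assms(2)] flip: mult.assoc)
  then have \<phi>J: "\<phi> (J * q) = \<i> * \<phi> q" for q
    by (simp add: \<phi>_def complex_eq_iff JJ)
  have "((\<lambda>z. (Re z, Im z)) has_derivative (\<lambda>z. (Re z, Im z))) (at z)"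
    by (intro has_derivative_Pair bounded_linear_imp_has_derivative bounded_linear_Re bounded_linear_Im)
  from has_derivative_compose[OF this D(1)]
  have "((\<lambda>z. f (of_real (Re z) + J * of_real (Im z))) has_derivative (\<lambda>w. D (Re w, Im w))) (at z)"
    by simp
  from \<phi>.has_derivative[OF this]
  have 1: "((\<lambda>z. \<phi> (f (of_real (Re z) + J * of_real (Im z)))) has_derivative (\<lambda>w. \<phi> (D (Re w, Im w)))) (at z)" .
  have "\<phi> (D (Re w, Im w)) = \<phi> (D (1, 0)) * w" for w
  proof -
    have "(Re w, Im w) = Re w *\<^sub>R (1, 0) + Im w *\<^sub>R (0, 1)" by simp
    then have "D (Re w, Im w) = Re w *\<^sub>R D (1, 0) + Im w *\<^sub>R (J * D (1, 0))"
      by (simp only: D.add D.scaleR e)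
    then have "\<phi> (D (Re w, Im w)) = Re w *\<^sub>R \<phi> (D (1, 0)) + Im w *\<^sub>R (\<i> * \<phi> (D (1, 0)))"
      by (simp only: \<phi>.add \<phi>.scaleR \<phi>J)
    also have "\<dots> = \<phi> (D (1, 0)) * w" by (simp add: complex_eq_iff algebra_simps)
    finally show ?thesis .
  qed
  then have 2: "(\<lambda>w. \<phi> (D (Re w, Im w))) = (*) (\<phi> (D (1, 0)))" by auto
  have "((\<lambda>z. \<phi> (f (of_real (Re z) + J * of_real (Im z)))) has_field_derivative \<phi> (D (1, 0))) (at z)"
    using 1 unfolding has_field_derivative_def 2 .
  then show "(\<lambda>z. \<phi> (f (of_real (Re z) + J * of_real (Im z)))) field_differentiable
      at z within {z. of_real (Re z) + J * of_real (Im z) \<in> \<Omega>}"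
    using field_differentiable_at_within field_differentiable_def by blast
qed

text \<open>The real zeros accumulate at \<open>x0\<close> inside the connected slice through q, so
  analytic continuation kills every coordinate function there. All slices share the real axis, hence
  one real neighbourhood serves every q.\<close>

lemma slice_regular_eq_0_near:
  assumes dom: "symmetric_slice_domain \<Omega>" and f: "f \<in> slice_regular \<Omega>"
    and x0: "of_real x0 \<in> \<Omega>" and ev: "eventually (\<lambda>x. f (of_real x) = 0) (at x0)" and q: "q \<in> \<Omega>"
  shows "f q = 0"
proof -
  obtain J x y where J: "J \<in> imag_units" and qJ: "q = of_real x + J * of_real y"
    using quat_polar by metis
  define D where "D = {z. of_real (Re z) + J * of_real (Im z) \<in> \<Omega>}"
  have oD: "open D"
  proof -
    have "open \<Omega>" using dom by (simp add: symmetric_slice_domain_def)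
    then have "open ((\<lambda>z. (Re z, Im z)) -` {(x, y). of_real x + J * of_real y \<in> \<Omega>})"
      by (intro open_vimage open_slice continuous_intros)
    then show ?thesis by (simp add: D_def vimage_def)
  qed
  have cD: "connected D" unfolding D_def by (rule connected_slice[OF dom J])
  have xD: "of_real x0 \<in> D" using x0 by (simp add: D_def)
  define U where "U = {z \<in> D. \<exists>x. z = of_real x \<and> f (of_real x) = 0}"
  have lim: "of_real x0 islimpt U"
    unfolding islimpt_approachable
  proof (intro allI impI)
    fix e :: real assume e: "e > 0"
    obtain d where d: "d > 0" "\<And>x. x \<noteq> x0 \<Longrightarrow> dist x x0 < d \<Longrightarrow> f (of_real x) = 0"
      using ev unfolding eventually_at by auto
    obtain r where r: "r > 0" "\<And>z. dist z (of_real x0) < r \<Longrightarrow> z \<in> D"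
      using oD xD unfolding open_dist by metis
    \<comment> \<open>Half the smallest radius gives a real point other than \<open>x0\<close> that
      is a zero, lies in the slice and is close enough.\<close>
    define x where "x = x0 + min e (min d r) / 2"
    have x: "x \<noteq> x0" "dist x x0 < e" "dist x x0 < d" "dist x x0 < r"
      using e d(1) r(1) by (auto simp: x_def dist_real_def)
    have dd: "dist (complex_of_real x) (of_real x0) = dist x x0"
      by (simp add: dist_norm flip: of_real_diff)
    have "complex_of_real x \<in> U" unfolding U_def using r(2)[of "of_real x"] d(2)[of x] x dd by auto
    then show "\<exists>x'\<in>U. x' \<noteq> complex_of_real x0 \<and> dist x' (complex_of_real x0) < e"
      using x dd by (intro bexI[of _ "complex_of_real x"]) auto
  qed
  have zero: "Complex (f q \<bullet> u) (f q \<bullet> (J * u)) = 0" for u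
  proof -
    let ?g = "\<lambda>z. Complex (f (of_real (Re z) + J * of_real (Im z)) \<bullet> u)
      (f (of_real (Re z) + J * of_real (Im z)) \<bullet> (J * u))"
    have "?g (Complex x y) = 0"
    proof (rule analytic_continuation[of ?g D U "of_real x0"])
      show "?g holomorphic_on D" unfolding D_def by (rule slice_coordinate_holomorphic[OF f J])
      show "U \<subseteq> D" by (auto simp: U_def)
      show "?g z = 0" if "z \<in> U" for z using that by (auto simp: U_def complex_eq_iff)
      show "Complex x y \<in> D" using q qJ by (simp add: D_def)
    qed (use oD cD xD lim in auto)
    then show ?thesis using qJ by simp
  qed
  \<comment> \<open>For u = f q the real part of the coordinate is the squared norm of f q.\<close>
  have "f q \<bullet> f q = 0" using zero[of "f q"] by (simp add: complex_eq_iff)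
  then show ?thesis by simp
qed

section \<open>Slice preserving components and the star product\<close>

lemma slice_regularD:
  assumes "f \<in> slice_regular \<Omega>" "J \<in> imag_units" "of_real x + J * of_real y \<in> \<Omega>"
  obtains D where "((\<lambda>(x, y). f (of_real x + J * of_real y)) has_derivative D) (at (x, y))"
    "D (1, 0) + J * D (0, 1) = 0"
  using assms unfolding slice_regular_def slice_holomorphic_def by fastforce

lemma slice_regularI:
  assumes "\<And>J x y. J \<in> imag_units \<Longrightarrow> of_real x + J * of_real y \<in> \<Omega> \<Longrightarrow>
    \<exists>D. ((\<lambda>(x, y). f (of_real x + J * of_real y)) has_derivative D) (at (x, y)) \<and>
      D (1, 0) + J * D (0, 1) = 0"
  shows "f \<in> slice_regular \<Omega>"
  using assms unfolding slice_regular_def slice_holomorphic_def by fastforce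

lemma slice_regular_add:
  assumes "f \<in> slice_regular \<Omega>" "g \<in> slice_regular \<Omega>"
  shows "(\<lambda>q. f q + g q) \<in> slice_regular \<Omega>"
proof (rule slice_regularI)
  fix J x y assume *: "J \<in> imag_units" "of_real x + J * of_real y \<in> \<Omega>"
  obtain D where D: "((\<lambda>(x, y). f (of_real x + J * of_real y)) has_derivative D) (at (x, y))"
    "D (1, 0) + J * D (0, 1) = 0" by (rule slice_regularD[OF assms(1) *])
  obtain E where E: "((\<lambda>(x, y). g (of_real x + J * of_real y)) has_derivative E) (at (x, y))"
    "E (1, 0) + J * E (0, 1) = 0" by (rule slice_regularD[OF assms(2) *])
  have "(D (1, 0) + E (1, 0)) + J * (D (0, 1) + E (0, 1)) =
    (D (1, 0) + J * D (0, 1)) + (E (1, 0) + J * E (0, 1))" by (simp add: algebra_simps)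
  then show "\<exists>D. ((\<lambda>(x, y). f (of_real x + J * of_real y) + g (of_real x + J * of_real y))
      has_derivative D) (at (x, y)) \<and> D (1, 0) + J * D (0, 1) = 0"
    using has_derivative_add[OF D(1) E(1)] D(2) E(2)
    by (intro exI[of _ "\<lambda>p. D p + E p"]) (simp add: case_prod_beta')
qed

text \<open>The constant stands on the right because the Cauchy-Riemann operator acts from the left;
  a left constant need not commute with J.\<close>

lemma slice_regular_mult_const:
  assumes "f \<in> slice_regular \<Omega>"
  shows "(\<lambda>q. f q * c) \<in> slice_regular \<Omega>"
proof (rule slice_regularI)
  fix J x y assume *: "J \<in> imag_units" "of_real x + J * of_real y \<in> \<Omega>"
  obtain D where D: "((\<lambda>(x, y). f (of_real x + J * of_real y)) has_derivative D) (at (x, y))"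
    "D (1, 0) + J * D (0, 1) = 0" by (rule slice_regularD[OF assms(1) *])
  have "D (1, 0) * c + J * (D (0, 1) * c) = (D (1, 0) + J * D (0, 1)) * c"
    by (simp add: algebra_simps)
  then show "\<exists>D. ((\<lambda>(x, y). f (of_real x + J * of_real y) * c) has_derivative D) (at (x, y)) \<and>
      D (1, 0) + J * D (0, 1) = 0"
    using has_derivative_mult_left[OF D(1), of c] D(2)
    by (intro exI[of _ "\<lambda>p. D p * c"]) (simp add: case_prod_beta')
qed

lemma slice_regular_uminus: "f \<in> slice_regular \<Omega> \<Longrightarrow> (\<lambda>q. - f q) \<in> slice_regular \<Omega>"
  using slice_regular_mult_const[of f \<Omega> "- 1"] by simp

lemma slice_regular_diff:
  "f \<in> slice_regular \<Omega> \<Longrightarrow> g \<in> slice_regular \<Omega> \<Longrightarrow> (\<lambda>q. f q - g q) \<in> slice_regular \<Omega>"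
  using slice_regular_add[OF _ slice_regular_uminus] by force

lemma slice_preserving_regular: "a \<in> slice_preserving \<Omega> \<Longrightarrow> a \<in> slice_regular \<Omega>"
  by (simp add: slice_preserving_def)

text \<open>On the slice of J the values of \<open>a\<close> lie in the plane of J and commute with
  J, so in the Leibniz rule J can be moved past \<open>a\<close> to the derivative of f.\<close>

lemma slice_regular_mult:
  assumes "a \<in> slice_preserving \<Omega>" "f \<in> slice_regular \<Omega>"
  shows "(\<lambda>q. a q * f q) \<in> slice_regular \<Omega>"
proof (rule slice_regularI)
  fix J x y assume *: "J \<in> imag_units" "of_real x + J * of_real y \<in> \<Omega>"
  let ?q = "of_real x + J * of_real y"
  obtain D where D: "((\<lambda>(x, y). a (of_real x + J * of_real y)) has_derivative D) (at (x, y))"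
    "D (1, 0) + J * D (0, 1) = 0" by (rule slice_regularD[OF slice_preserving_regular[OF assms(1)] *])
  obtain E where E: "((\<lambda>(x, y). f (of_real x + J * of_real y)) has_derivative E) (at (x, y))"
    "E (1, 0) + J * E (0, 1) = 0" by (rule slice_regularD[OF assms(2) *])
  have "?q \<in> slice_plane J" unfolding slice_plane_iff by blast
  then have "a ?q \<in> slice_plane J" using assms(1) * unfolding slice_preserving_def by blast
  then have comm: "a ?q * J = J * a ?q" by (rule slice_plane_commute)
  let ?D = "\<lambda>p. a ?q * E p + D p * f ?q"
  have "?D (1, 0) + J * ?D (0, 1) =
    a ?q * E (1, 0) + (J * a ?q) * E (0, 1) + (D (1, 0) + J * D (0, 1)) * f ?q"
    by (simp add: algebra_simps)
  also have "\<dots> = a ?q * (E (1, 0) + J * E (0, 1)) + (D (1, 0) + J * D (0, 1)) * f ?q"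
    unfolding comm[symmetric] by (simp add: algebra_simps)
  finally have "?D (1, 0) + J * ?D (0, 1) = 0" using D(2) E(2) by simp
  then show "\<exists>D. ((\<lambda>(x, y). a (of_real x + J * of_real y) * f (of_real x + J * of_real y))
      has_derivative D) (at (x, y)) \<and> D (1, 0) + J * D (0, 1) = 0"
    using has_derivative_mult[OF D(1) E(1)]
    by (intro exI[of _ ?D]) (simp add: case_prod_beta')
qed

lemma subspace_slice_plane: "subspace (slice_plane J)"
  by (simp add: slice_plane_def)

lemma slice_preservingI:
  assumes "f \<in> slice_regular \<Omega>"
    and "\<And>I q. I \<in> imag_units \<Longrightarrow> q \<in> \<Omega> \<Longrightarrow> q \<in> slice_plane I \<Longrightarrow> f q \<in> slice_plane I"
  shows "f \<in> slice_preserving \<Omega>"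
  using assms unfolding slice_preserving_def by blast

lemma slice_preservingD:
  "f \<in> slice_preserving \<Omega> \<Longrightarrow> I \<in> imag_units \<Longrightarrow> q \<in> \<Omega> \<Longrightarrow> q \<in> slice_plane I \<Longrightarrow> f q \<in> slice_plane I"
  unfolding slice_preserving_def by blast

lemma slice_preserving_diff:
  "a \<in> slice_preserving \<Omega> \<Longrightarrow> b \<in> slice_preserving \<Omega> \<Longrightarrow> (\<lambda>q. a q - b q) \<in> slice_preserving \<Omega>"
  by (intro slice_preservingI slice_regular_diff subspace_diff[OF subspace_slice_plane])
    (auto intro: slice_preserving_regular slice_preservingD)

lemma slice_preserving_mult:
  "a \<in> slice_preserving \<Omega> \<Longrightarrow> b \<in> slice_preserving \<Omega> \<Longrightarrow> (\<lambda>q. a q * b q) \<in> slice_preserving \<Omega>"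
  by (intro slice_preservingI slice_regular_mult slice_plane_times)
    (auto intro: slice_preserving_regular slice_preservingD)

lemma slice_preserving_scaleR:
  assumes "a \<in> slice_preserving \<Omega>"
  shows "(\<lambda>q. r *\<^sub>R a q) \<in> slice_preserving \<Omega>"
proof (rule slice_preservingI)
  show "(\<lambda>q. r *\<^sub>R a q) \<in> slice_regular \<Omega>"
    using slice_regular_mult_const[OF slice_preserving_regular[OF assms], of "of_real r"]
    by (simp add: scaleR_conv_of_real quat_of_real_commute)
qed (use assms in \<open>auto intro!: subspace_scale[OF subspace_slice_plane] intro: slice_preservingD\<close>)

text \<open>A real point lies in every slice plane, so the value lies in the intersection of the
  planes of \<open>quat_i\<close> and \<open>quat_j\<close>, which is the real line.\<close>

lemma slice_preserving_of_real:
  assumes "a \<in> slice_preserving \<Omega>" "of_real x \<in> \<Omega>"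
  shows "a (of_real x) = of_real (qre (a (of_real x)))"
proof -
  have "of_real x \<in> slice_plane J" for J
    unfolding slice_plane_iff by (intro exI[of _ x] exI[of _ 0]) simp
  then have "a (of_real x) \<in> slice_plane quat_i" "a (of_real x) \<in> slice_plane quat_j"
    using slice_preservingD[OF assms(1) _ assms(2)] by auto
  then show ?thesis by (auto simp: slice_plane_iff quat_eq_iff)
qed

section \<open>Uniqueness and absence of zero divisors, read off on the real axis\<close>

lemma slice_regular_eqI:
  assumes dom: "symmetric_slice_domain \<Omega>" and fg: "f \<in> slice_regular \<Omega>" "g \<in> slice_regular \<Omega>"
    and eq: "\<And>x. of_real x \<in> \<Omega> \<Longrightarrow> f (of_real x) = g (of_real x)" and q: "q \<in> \<Omega>"
  shows "f q = g q"
proof -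
  obtain x0 where x0: "of_real x0 \<in> \<Omega>"
    using dom unfolding symmetric_slice_domain_def by (auto elim!: Reals_cases)
  have "open \<Omega>" using dom by (simp add: symmetric_slice_domain_def)
  moreover have "((of_real :: real \<Rightarrow> quat) \<longlongrightarrow> of_real x0) (at x0)" by (intro tendsto_intros)
  ultimately have "eventually (\<lambda>x. of_real x \<in> \<Omega>) (at x0)" using x0 topological_tendstoD by blast
  then have "eventually (\<lambda>x. f (of_real x) - g (of_real x) = 0) (at x0)"
    by eventually_elim (simp add: eq)
  from slice_regular_eq_0_near[OF dom slice_regular_diff[OF fg] x0 this q] show ?thesis by simp
qed

text \<open>Differentiability is given slice by slice, so continuity along the real axis is taken
  from the slice of \<open>quat_i\<close>.\<close>

lemma slice_regular_tendsto_real: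
  assumes "f \<in> slice_regular \<Omega>" "of_real x \<in> \<Omega>"
  shows "((\<lambda>x. f (of_real x)) \<longlongrightarrow> f (of_real x)) (at x)"
proof -
  have "of_real x + quat_i * of_real 0 \<in> \<Omega>" using assms(2) by simp
  then obtain D where
    "((\<lambda>(x, y). f (of_real x + quat_i * of_real y)) has_derivative D) (at (x, 0))"
    by (rule slice_regularD[OF assms(1) quat_units_imag_units(1)])
  from has_derivative_continuous[OF this]
  have "isCont (\<lambda>(x, y). f (of_real x + quat_i * of_real y)) (x, 0)" .
  moreover have "isCont (\<lambda>x::real. (x, 0::real)) x" by (intro continuous_intros)
  ultimately have "isCont (\<lambda>x. (\<lambda>(x, y). f (of_real x + quat_i * of_real y)) (x, 0)) x"
    by (rule isCont_o2[rotated])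
  then show ?thesis by (simp add: isCont_def)
qed

text \<open>By the identity principle \<open>a\<close> is nonzero at some real point, by continuity
  also nearby; so f vanishes near that point and therefore everywhere. The product has to vanish at
  real points only, the form in which this is met later.\<close>

lemma slice_preserving_mult_eq_0:
  assumes dom: "symmetric_slice_domain \<Omega>" and a: "a \<in> slice_preserving \<Omega>" and f: "f \<in> slice_regular \<Omega>"
    and nz: "p \<in> \<Omega>" "a p \<noteq> 0"
    and eq: "\<And>x. of_real x \<in> \<Omega> \<Longrightarrow> a (of_real x) * f (of_real x) = 0" and q: "q \<in> \<Omega>"
  shows "f q = 0"
proof -
  have zero: "(\<lambda>_. 0) \<in> slice_regular \<Omega>"
    using slice_regular_mult_const[OF f, of 0] by simp
  have ar: "a \<in> slice_regular \<Omega>" using a by (rule slice_preserving_regular)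
  obtain x where x: "of_real x \<in> \<Omega>" "a (of_real x) \<noteq> 0"
    using slice_regular_eqI[OF dom ar zero _ nz(1)] nz(2) by blast
  have "open \<Omega>" using dom by (simp add: symmetric_slice_domain_def)
  moreover have "((of_real :: real \<Rightarrow> quat) \<longlongrightarrow> of_real x) (at x)" by (intro tendsto_intros)
  ultimately have "eventually (\<lambda>x. of_real x \<in> \<Omega>) (at x)" using x topological_tendstoD by blast
  moreover have "eventually (\<lambda>x. a (of_real x) \<noteq> 0) (at x)"
    by (rule tendsto_imp_eventually_ne[OF slice_regular_tendsto_real[OF ar x(1)] x(2)])
  ultimately have "eventually (\<lambda>x. f (of_real x) = 0) (at x)"
    by eventually_elim (use eq in auto)
  from slice_regular_eq_0_near[OF dom f x(1) this q] show ?thesis .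
qed

text \<open>The witness is \<open>L b + I (L c)\<close> for the stem functions \<open>b\<close>, \<open>c\<close> of \<open>f\<close>, read off on one slice:
  \<open>b\<close> is even and \<open>c\<close> is odd in \<open>\<beta>\<close>, so this does not depend on the choice of the sign of \<open>I\<close>.\<close>

lemma slice_preserving_component:
  fixes L :: "quat \<Rightarrow> real"
  assumes dom: "symmetric_slice_domain \<Omega>" and f: "f \<in> slice_regular \<Omega>" and L: "bounded_linear L"
  shows "\<exists>a\<in>slice_preserving \<Omega>. \<forall>x. of_real x \<in> \<Omega> \<longrightarrow> a (of_real x) = of_real (L (f (of_real x)))"
proof -
  interpret L: bounded_linear L by (rule L)
  define F where "F = (\<lambda>(x, y). f (of_real x + quat_i * of_real y))"
  \<comment> \<open>Solves F (x, y) = b + i c and F (x, - y) = b - i c for b and c.\<close>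
  define b where "b = (\<lambda>(x, y). (1 / 2) *\<^sub>R (F (x, y) + F (x, - y)))"
  define c where "c = (\<lambda>(x, y). (1 / 2) *\<^sub>R (quat_i * (F (x, - y) - F (x, y))))"
  \<comment> \<open>At real points the normalized imaginary part is 0 by the convention for division
    by 0; this is harmless because c vanishes for y = 0.\<close>
  define a where "a = (\<lambda>q. of_real (L (b (qre q, norm (qim q)))) +
    (qim q /\<^sub>R norm (qim q)) * of_real (L (c (qre q, norm (qim q)))))"
  have a_slice: "a (of_real x + J * of_real y) = of_real (L (b (x, y))) + J * of_real (L (c (x, y)))"
    if J: "J \<in> imag_units" for x y J
  proof -
    \<comment> \<open>The definition of \<open>a\<close> sees only |y|; the parities recover the
      formula for negative y.\<close>
    have *: "b (x, - y) = b (x, y)" "c (x, - y) = - c (x, y)"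
      by (simp_all add: b_def c_def algebra_simps)
    have eq: "a (of_real x + J * of_real y) = of_real (L (b (x, \<bar>y\<bar>))) +
      ((J * of_real y) /\<^sub>R \<bar>y\<bar>) * of_real (L (c (x, \<bar>y\<bar>)))"
      unfolding a_def qre_slice[OF J] qim_slice[OF J] norm_qim_slice[OF J, unfolded qim_slice[OF J]] ..
    show ?thesis
    proof (cases y "0 :: real" rule: linorder_cases)
      case less
      then have "(J * of_real y) /\<^sub>R \<bar>y\<bar> = - J" by (simp add: quat_eq_iff)
      then show ?thesis using eq less * by (simp add: L.neg)
    next
      case equal
      then have "c (x, y) = 0" by (simp add: c_def)
      then show ?thesis using eq equal by (simp add: L.zero)
    next
      case greater
      then have "(J * of_real y) /\<^sub>R \<bar>y\<bar> = J" by (simp add: quat_eq_iff)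
      then show ?thesis using eq greater by simp
    qed
  qed
  have "a \<in> slice_regular \<Omega>"
  proof (rule slice_regularI)
    fix J x y assume J: "J \<in> imag_units" and m: "of_real x + J * of_real y \<in> \<Omega>"
    have m1: "of_real x + quat_i * of_real y \<in> \<Omega>"
      using slice_mem_iff[OF dom J quat_units_imag_units(1)] m by blast
    then have m2: "of_real x + quat_i * of_real (- y) \<in> \<Omega>"
      using slice_mem_uminus_iff[OF dom quat_units_imag_units(1)] by blast
    obtain D where D: "(F has_derivative D) (at (x, y))" "D (1, 0) + quat_i * D (0, 1) = 0"
      unfolding F_def by (rule slice_regularD[OF f quat_units_imag_units(1) m1])
    obtain E where E: "(F has_derivative E) (at (x, - y))" "E (1, 0) + quat_i * E (0, 1) = 0"
      unfolding F_def by (rule slice_regularD[OF f quat_units_imag_units(1) m2])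
    have "((\<lambda>p :: real \<times> real. (fst p, - snd p)) has_derivative (\<lambda>p. (fst p, - snd p))) (at (x, y))"
      by (auto intro!: derivative_eq_intros)
    from has_derivative_compose[OF this, of F E] E(1)
    have E': "((\<lambda>p. F (fst p, - snd p)) has_derivative (\<lambda>p. E (fst p, - snd p))) (at (x, y))" by simp
    let ?b = "\<lambda>p. (1 / 2) *\<^sub>R (D p + E (fst p, - snd p))"
    let ?c = "\<lambda>p. (1 / 2) *\<^sub>R (quat_i * (E (fst p, - snd p) - D p))"
    have db: "(b has_derivative ?b) (at (x, y))"
      using has_derivative_scaleR_right[OF has_derivative_add[OF D(1) E']]
      by (simp add: b_def case_prod_beta')
    have dc: "(c has_derivative ?c) (at (x, y))"
      using has_derivative_scaleR_right[OF has_derivative_mult_right[OF has_derivative_diff[OF E' D(1)]]]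
      by (simp add: c_def case_prod_beta')
    interpret E: bounded_linear E using E(1) by (rule has_derivative_bounded_linear)
    have "E (0, - 1) = - E (0, 1)" using E.neg[of "(0, 1)"] by simp
    moreover have "D (1, 0) = - (quat_i * D (0, 1))" "E (1, 0) = - (quat_i * E (0, 1))"
      using D(2) E(2) by (simp_all add: add_eq_0_iff2)
    \<comment> \<open>The Cauchy-Riemann equations of the pair b, c. No imaginary unit is left in
      them, so they survive applying \<open>L\<close> and can be used on the slice of any J.\<close>
    ultimately have cr: "?c (0, 1) = ?b (1, 0)" "?c (1, 0) = - ?b (0, 1)"
      by (auto simp: quat_eq_iff field_simps)
    let ?A = "\<lambda>p. of_real (L (?b p)) + J * of_real (L (?c p))"
    have "((\<lambda>p. of_real (L (b p)) + J * of_real (L (c p))) has_derivative ?A) (at (x, y))"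
      by (intro has_derivative_add has_derivative_mult_right has_derivative_of_real
          L.has_derivative db dc)
    moreover have "?A (1, 0) + J * ?A (0, 1) = 0"
    proof -
      have "?A (1, 0) + J * ?A (0, 1) = of_real (L (?b (1, 0))) - J * of_real (L (?b (0, 1)))
        + J * (of_real (L (?b (0, 1)))) + (J * J) * of_real (L (?b (1, 0)))"
        unfolding cr L.neg by (simp only: distrib_left mult.assoc) (simp add: algebra_simps)
      then show ?thesis by (simp add: imag_unit_square[OF J])
    qed
    moreover have "(\<lambda>(x, y). a (of_real x + J * of_real y)) = (\<lambda>p. of_real (L (b p)) + J * of_real (L (c p)))"
      using a_slice[OF J] by auto
    ultimately show "\<exists>D. ((\<lambda>(x, y). a (of_real x + J * of_real y)) has_derivative D) (at (x, y)) \<and>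
      D (1, 0) + J * D (0, 1) = 0" by (intro exI[of _ ?A]) simp
  qed
  then have "a \<in> slice_preserving \<Omega>"
    by (rule slice_preservingI) (use a_slice in \<open>force simp: slice_plane_iff\<close>)
  moreover have "a (of_real x) = of_real (L (f (of_real x)))" if "of_real x \<in> \<Omega>" for x
  proof -
    have "L (c (x, 0)) = 0" by (simp add: c_def L.zero)
    moreover have "b (x, 0) = f (of_real x)" by (simp add: b_def F_def quat_eq_iff)
    ultimately show ?thesis using a_slice[OF quat_units_imag_units(1), of x 0] by simp
  qed
  ultimately show ?thesis by blast
qed

lemma slice_preserving_inner_component:
  assumes "symmetric_slice_domain \<Omega>" "f \<in> slice_regular \<Omega>"
  obtains a where "a \<in> slice_preserving \<Omega>"
    "\<forall>x. of_real x \<in> \<Omega> \<longrightarrow> a (of_real x) = of_real (f (of_real x) \<bullet> u)"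
  using slice_preserving_component[OF assms bounded_linear_inner_left[of u]] by blast

text \<open>On the real axis such a function equals its own coordinate along 1, which extends to a
  slice preserving function; the identity principle carries the equality to \<Omega>.\<close>

lemma slice_regular_real_imp_preserving:
  assumes dom: "symmetric_slice_domain \<Omega>" and f: "f \<in> slice_regular \<Omega>"
    and re: "\<And>x. of_real x \<in> \<Omega> \<Longrightarrow> f (of_real x) \<in> \<real>"
  shows "f \<in> slice_preserving \<Omega>"
proof -
  obtain a where a: "a \<in> slice_preserving \<Omega>"
    "\<forall>x. of_real x \<in> \<Omega> \<longrightarrow> a (of_real x) = of_real (f (of_real x) \<bullet> 1)"
    using slice_preserving_inner_component[OF dom f, where u = 1] by blast
  have "a (of_real x) = f (of_real x)" if "of_real x \<in> \<Omega>" for x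
    using a(2)[rule_format, OF that] re[OF that] by (auto elim!: Reals_cases simp: inner_quat_def)
  then have "a q = f q" if "q \<in> \<Omega>" for q
    using slice_regular_eqI[OF dom slice_preserving_regular[OF a(1)] f _ that] by blast
  then show ?thesis using slice_preserving_cong a(1) dom
    unfolding symmetric_slice_domain_def by blast
qed

text \<open>For the converse, let a and b be the coordinates of f along 1 and M. Then f = a + b M at
  real points, hence on \<Omega> by the identity principle, and the plane of M is closed under sums
  and products.\<close>

lemma slice_regular_on_iff:
  assumes dom: "symmetric_slice_domain \<Omega>" and f: "f \<in> slice_regular \<Omega>" and M: "M \<in> imag_units"
  shows "f \<in> slice_regular_on \<Omega> M \<longleftrightarrow> (\<forall>x. of_real x \<in> \<Omega> \<longrightarrow> f (of_real x) \<in> slice_plane M)"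
proof
  have "of_real x \<in> slice_plane M" for x
    unfolding slice_plane_iff by (intro exI[of _ x] exI[of _ 0]) simp
  then show "f \<in> slice_regular_on \<Omega> M \<Longrightarrow> \<forall>x. of_real x \<in> \<Omega> \<longrightarrow> f (of_real x) \<in> slice_plane M"
    unfolding slice_regular_on_def by blast
next
  assume *: "\<forall>x. of_real x \<in> \<Omega> \<longrightarrow> f (of_real x) \<in> slice_plane M"
  obtain a where a: "a \<in> slice_preserving \<Omega>"
    "\<forall>x. of_real x \<in> \<Omega> \<longrightarrow> a (of_real x) = of_real (f (of_real x) \<bullet> 1)"
    using slice_preserving_inner_component[OF dom f, where u = 1] by blast
  obtain b where b: "b \<in> slice_preserving \<Omega>"
    "\<forall>x. of_real x \<in> \<Omega> \<longrightarrow> b (of_real x) = of_real (f (of_real x) \<bullet> M)"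
    using slice_preserving_inner_component[OF dom f, where u = M] by blast
  have M': "qre M = 0" "M \<bullet> M = 1"
    using M by (auto simp: imag_units_iff norm_eq_1)
  have "f (of_real x) = a (of_real x) + b (of_real x) * M" if x: "of_real x \<in> \<Omega>" for x
  proof -
    obtain u v where "f (of_real x) = of_real u + M * of_real v"
      using * x slice_plane_iff by blast
    then have uv: "f (of_real x) = of_real u + v *\<^sub>R M"
      by (simp add: scaleR_conv_of_real quat_of_real_commute)
    have "f (of_real x) \<bullet> 1 = u" using M'(1) unfolding uv by (simp add: inner_quat_def)
    moreover have "f (of_real x) \<bullet> M = v"
    proof -
      have "of_real u \<bullet> M = 0" using M'(1) by (simp add: inner_quat_def)
      then show ?thesis unfolding uv by (simp add: inner_add_left M'(2))
    qed
    ultimately show ?thesis using uv a(2)[rule_format, OF x] b(2)[rule_format, OF x] by (simp add: scaleR_conv_of_real)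
  qed
  then have eq: "f q = a q + b q * M" if "q \<in> \<Omega>" for q
    using slice_regular_eqI[OF dom f slice_regular_add[OF slice_preserving_regular[OF a(1)]
        slice_regular_mult_const[OF slice_preserving_regular[OF b(1)], of M]] _ that] by blast
  have "M \<in> slice_plane M" by (simp add: slice_plane_def span_base)
  then have "f q \<in> slice_plane M" if "q \<in> \<Omega>" "q \<in> slice_plane M" for q
    unfolding eq[OF that(1)]
    by (intro subspace_add[OF subspace_slice_plane] slice_plane_times M
        slice_preservingD[OF a(1) M that] slice_preservingD[OF b(1) M that])
  then show "f \<in> slice_regular_on \<Omega> M" using f unfolding slice_regular_on_def by blast
qed

text \<open>The choice in \<open>slice_decomp\<close> is harmless: slice preserving functions are
  real on the real axis, so comparing quaternion components there fixes every admissible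
  decomposition. Later proofs use only these values and that the components are slice
  preserving.\<close>

lemma slice_decomp_real:
  assumes dom: "symmetric_slice_domain \<Omega>" and f: "f \<in> slice_regular \<Omega>"
  obtains f0 f1 f2 f3 where "slice_decomp \<Omega> f = (f0, f1, f2, f3)"
    "f0 \<in> slice_preserving \<Omega>" "f1 \<in> slice_preserving \<Omega>" "f2 \<in> slice_preserving \<Omega>" "f3 \<in> slice_preserving \<Omega>"
    "\<forall>x. of_real x \<in> \<Omega> \<longrightarrow> f0 (of_real x) = of_real (qre (f (of_real x)))"
    "\<forall>x. of_real x \<in> \<Omega> \<longrightarrow> f1 (of_real x) = of_real (qim1 (f (of_real x)))"
    "\<forall>x. of_real x \<in> \<Omega> \<longrightarrow> f2 (of_real x) = of_real (qim2 (f (of_real x)))"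
    "\<forall>x. of_real x \<in> \<Omega> \<longrightarrow> f3 (of_real x) = of_real (qim3 (f (of_real x)))"
proof -
  have "\<exists>c. is_slice_decomp \<Omega> f c"
  proof -
    obtain a where a: "a \<in> slice_preserving \<Omega>"
      "\<forall>x. of_real x \<in> \<Omega> \<longrightarrow> a (of_real x) = of_real (f (of_real x) \<bullet> 1)"
      using slice_preserving_inner_component[OF dom f, where u = 1] by blast
    obtain b where b: "b \<in> slice_preserving \<Omega>"
      "\<forall>x. of_real x \<in> \<Omega> \<longrightarrow> b (of_real x) = of_real (f (of_real x) \<bullet> quat_i)"
      using slice_preserving_inner_component[OF dom f, where u = quat_i] by blast
    obtain c where c: "c \<in> slice_preserving \<Omega>"
      "\<forall>x. of_real x \<in> \<Omega> \<longrightarrow> c (of_real x) = of_real (f (of_real x) \<bullet> quat_j)"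
      using slice_preserving_inner_component[OF dom f, where u = quat_j] by blast
    obtain d where d: "d \<in> slice_preserving \<Omega>"
      "\<forall>x. of_real x \<in> \<Omega> \<longrightarrow> d (of_real x) = of_real (f (of_real x) \<bullet> quat_k)"
      using slice_preserving_inner_component[OF dom f, where u = quat_k] by blast
    have r: "(\<lambda>q. a q + b q * quat_i + c q * quat_j + d q * quat_k) \<in> slice_regular \<Omega>"
      by (intro slice_regular_add slice_regular_mult_const slice_preserving_regular a(1) b(1) c(1) d(1))
    have "f (of_real x) = a (of_real x) + b (of_real x) * quat_i + c (of_real x) * quat_j + d (of_real x) * quat_k"
      if "of_real x \<in> \<Omega>" for x
      unfolding a(2)[rule_format, OF that] b(2)[rule_format, OF that] c(2)[rule_format, OF that] d(2)[rule_format, OF that]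
      by (simp add: quat_eq_iff inner_quat_def)
    then have "f q = a q + b q * quat_i + c q * quat_j + d q * quat_k" if "q \<in> \<Omega>" for q
      using slice_regular_eqI[OF dom f r _ that] by blast
    then show ?thesis
      using a(1) b(1) c(1) d(1) by (intro exI[of _ "(a, b, c, d)"]) (simp add: is_slice_decomp_def)
  qed
  then have "is_slice_decomp \<Omega> f (slice_decomp \<Omega> f)" unfolding slice_decomp_def by (rule someI_ex)
  moreover obtain f0 f1 f2 f3 where eq: "slice_decomp \<Omega> f = (f0, f1, f2, f3)" by (metis prod_cases4)
  ultimately have sp: "f0 \<in> slice_preserving \<Omega>" "f1 \<in> slice_preserving \<Omega>" "f2 \<in> slice_preserving \<Omega>"
    "f3 \<in> slice_preserving \<Omega>"
    and dec: "\<And>q. q \<in> \<Omega> \<Longrightarrow> f q = f0 q + f1 q * quat_i + f2 q * quat_j + f3 q * quat_k"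
    by (simp_all add: is_slice_decomp_def)
  have vals: "f0 (of_real x) = of_real (qre (f (of_real x))) \<and> f1 (of_real x) = of_real (qim1 (f (of_real x)))
    \<and> f2 (of_real x) = of_real (qim2 (f (of_real x))) \<and> f3 (of_real x) = of_real (qim3 (f (of_real x)))"
    if x: "of_real x \<in> \<Omega>" for x
  proof -
    obtain r0 r1 r2 r3 where r: "f0 (of_real x) = of_real r0" "f1 (of_real x) = of_real r1"
      "f2 (of_real x) = of_real r2" "f3 (of_real x) = of_real r3"
      using slice_preserving_of_real[OF _ x] sp by metis
    show ?thesis using dec[OF x] unfolding r by (simp add: quat_eq_iff)
  qed
  show thesis by (rule that[OF eq sp]) (use vals in blast)+
qed

section \<open>Star product, regular conjugate and quotient on the real axis\<close>

definition quat_cnj :: "quat \<Rightarrow> quat" where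
  "quat_cnj q = Quat (qre q) (- qim1 q) (- qim2 q) (- qim3 q)"

lemma quat_cnj_sel [simp]: "qre (quat_cnj q) = qre q" "qim1 (quat_cnj q) = - qim1 q"
  "qim2 (quat_cnj q) = - qim2 q" "qim3 (quat_cnj q) = - qim3 q"
  by (simp_all add: quat_cnj_def)

text \<open>At real points the components are real and commute with everything, so the defining
  formula is the multiplication of quaternions. With the identity principle this replaces
  calculations with the star product, including triple products.\<close>

lemma star_prod_regular:
  assumes "symmetric_slice_domain \<Omega>" "f \<in> slice_regular \<Omega>" "g \<in> slice_regular \<Omega>"
  shows "star_prod \<Omega> f g \<in> slice_regular \<Omega>"
    and "of_real x \<in> \<Omega> \<Longrightarrow> star_prod \<Omega> f g (of_real x) = f (of_real x) * g (of_real x)"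
proof -
  obtain f0 f1 f2 f3 where f: "slice_decomp \<Omega> f = (f0, f1, f2, f3)"
    "f0 \<in> slice_preserving \<Omega>" "f1 \<in> slice_preserving \<Omega>" "f2 \<in> slice_preserving \<Omega>" "f3 \<in> slice_preserving \<Omega>"
    "\<forall>x. of_real x \<in> \<Omega> \<longrightarrow> f0 (of_real x) = of_real (qre (f (of_real x)))"
    "\<forall>x. of_real x \<in> \<Omega> \<longrightarrow> f1 (of_real x) = of_real (qim1 (f (of_real x)))"
    "\<forall>x. of_real x \<in> \<Omega> \<longrightarrow> f2 (of_real x) = of_real (qim2 (f (of_real x)))"
    "\<forall>x. of_real x \<in> \<Omega> \<longrightarrow> f3 (of_real x) = of_real (qim3 (f (of_real x)))"
    by (rule slice_decomp_real[OF assms(1,2)])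
  obtain g0 g1 g2 g3 where g: "slice_decomp \<Omega> g = (g0, g1, g2, g3)"
    "g0 \<in> slice_preserving \<Omega>" "g1 \<in> slice_preserving \<Omega>" "g2 \<in> slice_preserving \<Omega>" "g3 \<in> slice_preserving \<Omega>"
    "\<forall>x. of_real x \<in> \<Omega> \<longrightarrow> g0 (of_real x) = of_real (qre (g (of_real x)))"
    "\<forall>x. of_real x \<in> \<Omega> \<longrightarrow> g1 (of_real x) = of_real (qim1 (g (of_real x)))"
    "\<forall>x. of_real x \<in> \<Omega> \<longrightarrow> g2 (of_real x) = of_real (qim2 (g (of_real x)))"
    "\<forall>x. of_real x \<in> \<Omega> \<longrightarrow> g3 (of_real x) = of_real (qim3 (g (of_real x)))"
    by (rule slice_decomp_real[OF assms(1,3)])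
  show "star_prod \<Omega> f g \<in> slice_regular \<Omega>"
    unfolding star_prod_def f(1) g(1) prod.case
    by (intro slice_regular_add slice_regular_diff slice_regular_mult_const slice_regular_mult
        slice_preserving_regular f(2-5) g(2-5))
  show "star_prod \<Omega> f g (of_real x) = f (of_real x) * g (of_real x)" if "of_real x \<in> \<Omega>"
    unfolding star_prod_def f(1) g(1) prod.case f(6-9)[rule_format, OF that] g(6-9)[rule_format, OF that]
    by (simp add: quat_eq_iff)
qed

lemma regular_conj_regular:
  assumes "symmetric_slice_domain \<Omega>" "f \<in> slice_regular \<Omega>"
  shows "regular_conj \<Omega> f \<in> slice_regular \<Omega>"
    and "of_real x \<in> \<Omega> \<Longrightarrow> regular_conj \<Omega> f (of_real x) = quat_cnj (f (of_real x))"
proof -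
  obtain f0 f1 f2 f3 where f: "slice_decomp \<Omega> f = (f0, f1, f2, f3)"
    "f0 \<in> slice_preserving \<Omega>" "f1 \<in> slice_preserving \<Omega>" "f2 \<in> slice_preserving \<Omega>" "f3 \<in> slice_preserving \<Omega>"
    "\<forall>x. of_real x \<in> \<Omega> \<longrightarrow> f0 (of_real x) = of_real (qre (f (of_real x)))"
    "\<forall>x. of_real x \<in> \<Omega> \<longrightarrow> f1 (of_real x) = of_real (qim1 (f (of_real x)))"
    "\<forall>x. of_real x \<in> \<Omega> \<longrightarrow> f2 (of_real x) = of_real (qim2 (f (of_real x)))"
    "\<forall>x. of_real x \<in> \<Omega> \<longrightarrow> f3 (of_real x) = of_real (qim3 (f (of_real x)))"
    by (rule slice_decomp_real[OF assms])
  show "regular_conj \<Omega> f \<in> slice_regular \<Omega>"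
    unfolding regular_conj_def f(1) prod.case
    by (intro slice_regular_diff slice_regular_mult_const slice_preserving_regular f(2-5))
  show "regular_conj \<Omega> f (of_real x) = quat_cnj (f (of_real x))" if "of_real x \<in> \<Omega>"
    unfolding regular_conj_def f(1) prod.case f(6-9)[rule_format, OF that]
    by (simp add: quat_eq_iff)
qed

lemma slice_real_part_preserving:
  assumes "symmetric_slice_domain \<Omega>" "f \<in> slice_regular \<Omega>"
  shows "slice_real_part \<Omega> f \<in> slice_preserving \<Omega>"
    and "of_real x \<in> \<Omega> \<Longrightarrow> slice_real_part \<Omega> f (of_real x) = of_real (qre (f (of_real x)))"
  unfolding slice_real_part_def by (rule slice_decomp_real[OF assms], simp)+

lemma symmetrized_preserving:
  assumes "symmetric_slice_domain \<Omega>" "h \<in> slice_regular \<Omega>"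
  shows "symmetrized \<Omega> h \<in> slice_preserving \<Omega>"
    and "of_real x \<in> \<Omega> \<Longrightarrow> symmetrized \<Omega> h (of_real x) = of_real (h (of_real x) \<bullet> h (of_real x))"
proof -
  note c = regular_conj_regular[OF assms]
  note s = star_prod_regular[OF assms c(1)]
  show *: "symmetrized \<Omega> h (of_real x) = of_real (h (of_real x) \<bullet> h (of_real x))" if "of_real x \<in> \<Omega>" for x
    unfolding symmetrized_def using that by (simp add: s(2) c(2) quat_eq_iff inner_quat_def)
  have "symmetrized \<Omega> h \<in> slice_regular \<Omega>"
    unfolding symmetrized_def by (rule s(1))
  then show "symmetrized \<Omega> h \<in> slice_preserving \<Omega>"
    by (rule slice_regular_real_imp_preserving[OF assms(1)]) (simp add: *)
qed

text \<open>The choice in \<open>slice_quot\<close> is pinned down by cancellation: \<sigma> times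
  the difference of two quotients is 0, and \<sigma> is not identically 0.\<close>

lemma slice_quot_eq:
  assumes dom: "symmetric_slice_domain \<Omega>" and s: "\<sigma> \<in> slice_preserving \<Omega>" "p \<in> \<Omega>" "\<sigma> p \<noteq> 0"
    and k: "is_slice_quot \<Omega> \<tau> \<sigma> \<kappa>" and q: "q \<in> \<Omega>"
  shows "slice_quot \<Omega> \<tau> \<sigma> q = \<kappa> q"
proof -
  have k': "is_slice_quot \<Omega> \<tau> \<sigma> (slice_quot \<Omega> \<tau> \<sigma>)"
    unfolding slice_quot_def by (rule someI[of _ \<kappa>]) (rule k)
  have "slice_quot \<Omega> \<tau> \<sigma> q - \<kappa> q = 0"
  proof (rule slice_preserving_mult_eq_0[OF dom s(1) _ s(2,3) _ q])
    show "(\<lambda>q. slice_quot \<Omega> \<tau> \<sigma> q - \<kappa> q) \<in> slice_regular \<Omega>"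
      using k k' by (simp add: is_slice_quot_def slice_regular_diff slice_preserving_regular)
    show "\<sigma> (of_real x) * (slice_quot \<Omega> \<tau> \<sigma> (of_real x) - \<kappa> (of_real x)) = 0" if "of_real x \<in> \<Omega>" for x
      using k k' that by (simp add: is_slice_quot_def right_diff_distrib) metis
  qed
  then show ?thesis by simp
qed

section \<open>Conjugation in an orthonormal frame\<close>

locale quat_frame =
  fixes I J K :: quat
  assumes I: "I \<in> imag_units" and J: "J \<in> imag_units" and orth: "I \<bullet> J = 0" and K: "K = I * J"
begin

lemma re: "qre I = 0" "qre J = 0" "qre K = 0"
  using I J orth by (auto simp: imag_units_iff K inner_quat_def)

text \<open>With K in coordinates, identities of the frame become polynomial consequences of the
  relations in \<open>coordinates\<close>, within reach of the method
  \<open>algebra\<close>.\<close>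

lemma K_sel: "qim1 K = qim2 I * qim3 J - qim3 I * qim2 J" "qim2 K = qim3 I * qim1 J - qim1 I * qim3 J"
  "qim3 K = qim1 I * qim2 J - qim2 I * qim1 J"
  by (simp_all add: K re)

lemma coordinates:
  "qim1 I * qim1 I + qim2 I * qim2 I + qim3 I * qim3 I = 1"
  "qim1 J * qim1 J + qim2 J * qim2 J + qim3 J * qim3 J = 1"
  "qim1 I * qim1 J + qim2 I * qim2 J + qim3 I * qim3 J = 0"
  using I J orth re by (auto simp: imag_units_iff norm_eq_1 inner_quat_def)

lemma inner_frame: "I \<bullet> I = 1" "J \<bullet> J = 1" "K \<bullet> K = 1" "I \<bullet> J = 0" "I \<bullet> K = 0" "J \<bullet> K = 0"
  "J \<bullet> I = 0" "K \<bullet> I = 0" "K \<bullet> J = 0" "of_real r \<bullet> I = 0" "of_real r \<bullet> J = 0" "of_real r \<bullet> K = 0"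
proof -
  show "I \<bullet> I = 1" "J \<bullet> J = 1" "I \<bullet> J = 0" "J \<bullet> I = 0"
    using coordinates by (simp_all add: inner_quat_def re mult.commute)
  show "of_real r \<bullet> I = 0" "of_real r \<bullet> J = 0" "of_real r \<bullet> K = 0"
    by (simp_all add: inner_quat_def re)
  show "K \<bullet> K = 1" using coordinates unfolding inner_quat_def re K_sel by algebra
  show "I \<bullet> K = 0" "K \<bullet> I = 0" "J \<bullet> K = 0" "K \<bullet> J = 0"
    unfolding inner_quat_def re K_sel by algebra+
qed

lemma expand: "q = of_real (qre q) + (q \<bullet> I) *\<^sub>R I + (q \<bullet> J) *\<^sub>R J + (q \<bullet> K) *\<^sub>R K"
proof -
  have "qim1 q = (q \<bullet> I) * qim1 I + (q \<bullet> J) * qim1 J + (q \<bullet> K) * qim1 K"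
    using coordinates unfolding inner_quat_def re K_sel by algebra
  moreover have "qim2 q = (q \<bullet> I) * qim2 I + (q \<bullet> J) * qim2 J + (q \<bullet> K) * qim2 K"
    using coordinates unfolding inner_quat_def re K_sel by algebra
  moreover have "qim3 q = (q \<bullet> I) * qim3 I + (q \<bullet> J) * qim3 J + (q \<bullet> K) * qim3 K"
    using coordinates unfolding inner_quat_def re K_sel by algebra
  ultimately show ?thesis by (simp add: quat_eq_iff re)
qed

lemma mult_table: "I * I = - 1" "I * J = K" "J * I = - K" "I * K = - J" "K * I = J"
proof -
  show "I * I = - 1" by (rule imag_unit_square[OF I])
  show "I * J = K" by (simp add: K)
  have "J * I = - (I * J)"
    using coordinates(3) by (simp add: quat_eq_iff re)
  then show JI: "J * I = - K" by (simp add: K)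
  show "I * K = - J" by (simp add: K imag_unit_square[OF I] flip: mult.assoc)
  have "K * I = I * (J * I)" by (simp add: K mult.assoc)
  then show "K * I = J" by (simp add: JI K imag_unit_square[OF I] flip: mult.assoc)
qed

text \<open>J and K anticommute with I, so moving them past the conjugate s - t I turns it into s +
  t I; this gives the factor (s + t I)^2 = s^2 - t^2 + 2 s t I on the J-K plane. 1 and I commute
  with it, which gives s^2 + t^2.\<close>

lemma conj_expand:
  "(of_real s + t *\<^sub>R I) * q * quat_cnj (of_real s + t *\<^sub>R I) =
    of_real ((s\<^sup>2 + t\<^sup>2) * qre q) + ((s\<^sup>2 + t\<^sup>2) * (q \<bullet> I)) *\<^sub>R I
    + ((s\<^sup>2 - t\<^sup>2) * (q \<bullet> J) - 2 * s * t * (q \<bullet> K)) *\<^sub>R J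
    + (2 * s * t * (q \<bullet> J) + (s\<^sup>2 - t\<^sup>2) * (q \<bullet> K)) *\<^sub>R K"
proof -
  define u v1 v2 v3 where uv: "u = qre q" "v1 = q \<bullet> I" "v2 = q \<bullet> J" "v3 = q \<bullet> K"
  have q: "q = of_real u + v1 *\<^sub>R I + v2 *\<^sub>R J + v3 *\<^sub>R K"
    unfolding uv by (rule expand)
  have c: "quat_cnj (of_real s + t *\<^sub>R I) = s *\<^sub>R 1 - t *\<^sub>R I"
    by (simp add: quat_eq_iff re)
  have "(of_real s + t *\<^sub>R I) * (of_real u + v1 *\<^sub>R I + v2 *\<^sub>R J + v3 *\<^sub>R K) * (s *\<^sub>R 1 - t *\<^sub>R I) =
    of_real ((s\<^sup>2 + t\<^sup>2) * u) + ((s\<^sup>2 + t\<^sup>2) * v1) *\<^sub>R I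
    + ((s\<^sup>2 - t\<^sup>2) * v2 - 2 * s * t * v3) *\<^sub>R J
    + (2 * s * t * v2 + (s\<^sup>2 - t\<^sup>2) * v3) *\<^sub>R K"
    unfolding of_real_def
    by (simp add: distrib_left distrib_right left_diff_distrib right_diff_distrib mult_table
        power2_eq_square)
      (simp add: quat_eq_iff re algebra_simps)
  then show ?thesis using q c uv by metis
qed

text \<open>The vector part of w has to be a multiple of (a, b, 0) in the frame; the second
  condition expresses this proportionality without division, so that a or b may be 0.\<close>

lemma slice_plane_iff_inner:
  assumes "a\<^sup>2 + b\<^sup>2 = 1"
  shows "w \<in> slice_plane (a *\<^sub>R I + b *\<^sub>R J) \<longleftrightarrow> w \<bullet> K = 0 \<and> a * (w \<bullet> J) = b * (w \<bullet> I)"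
proof
  assume "w \<in> slice_plane (a *\<^sub>R I + b *\<^sub>R J)"
  then obtain x y where "w = of_real x + y *\<^sub>R (a *\<^sub>R I + b *\<^sub>R J)"
    unfolding slice_plane_iff by (auto simp: scaleR_conv_of_real quat_of_real_commute mult.assoc)
  then show "w \<bullet> K = 0 \<and> a * (w \<bullet> J) = b * (w \<bullet> I)"
    by (simp add: inner_add_left inner_frame)
next
  assume *: "w \<bullet> K = 0 \<and> a * (w \<bullet> J) = b * (w \<bullet> I)"
  \<comment> \<open>The coordinate of w along the unit vector a I + b J.\<close>
  let ?y = "a * (w \<bullet> I) + b * (w \<bullet> J)"
  have "w \<bullet> I = ?y * a" "w \<bullet> J = ?y * b" using * assms by algebra+
  then have "w = of_real (qre w) + (?y * a) *\<^sub>R I + (?y * b) *\<^sub>R J"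
    using expand[of w] * by simp
  also have "\<dots> = of_real (qre w) + (a *\<^sub>R I + b *\<^sub>R J) * of_real ?y"
    by (simp add: of_real_def algebra_simps)
  finally show "w \<in> slice_plane (a *\<^sub>R I + b *\<^sub>R J)" unfolding slice_plane_iff by blast
qed

lemma conj_in_slice_plane_iff:
  assumes "a\<^sup>2 + b\<^sup>2 = 1"
  shows "(of_real s + t *\<^sub>R I) * q * quat_cnj (of_real s + t *\<^sub>R I) \<in> slice_plane (a *\<^sub>R I + b *\<^sub>R J) \<longleftrightarrow>
    2 * s * t * (q \<bullet> J) + (s\<^sup>2 - t\<^sup>2) * (q \<bullet> K) = 0 \<and>
    a * ((s\<^sup>2 - t\<^sup>2) * (q \<bullet> J) - 2 * s * t * (q \<bullet> K)) = b * ((s\<^sup>2 + t\<^sup>2) * (q \<bullet> I))"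
  unfolding slice_plane_iff_inner[OF assms] conj_expand
  by (simp add: inner_add_left inner_frame del: of_real_mult of_real_add)

end

section \<open>Frames adapted to given imaginary units\<close>

lemma quat_frame_exists:
  assumes "I \<in> imag_units"
  obtains J where "quat_frame I J (I * J)"
proof -
  \<comment> \<open>The span of 1 and I is a proper subspace of the four-dimensional quaternions; a
    nonzero vector orthogonal to it is imaginary and orthogonal to I.\<close>
  have "dim {1, I} < DIM(quat)"
  proof -
    have "dim {1, I} \<le> card {1, I}" by (rule dim_le_card') simp
    also have "\<dots> \<le> 2" by (simp add: card_insert_if)
    also have "2 < DIM(quat)" by (simp add: Basis_quat_def quat_eq_iff)
    finally show ?thesis .
  qed
  then obtain x where x: "x \<noteq> 0" "\<And>y. y \<in> span {1, I} \<Longrightarrow> orthogonal x y"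
    using orthogonal_to_subspace_exists by metis
  have "1 \<bullet> x = 0" "I \<bullet> x = 0"
    using x(2)[OF span_base, of 1] x(2)[OF span_base, of I] by (simp_all add: orthogonal_def inner_commute)
  then have "qre x = 0" "I \<bullet> (x /\<^sub>R norm x) = 0" by (simp_all add: inner_quat_def[of 1])
  then have "quat_frame I (x /\<^sub>R norm x) (I * (x /\<^sub>R norm x))"
    using assms x(1) by unfold_locales (simp_all add: imag_units_iff)
  then show thesis by (rule that)
qed

text \<open>A product of imaginary quaternions has minus the inner product as real part and the
  cross product as vector part. This trades the wedge for quaternion algebra.\<close>

lemma quat_wedge_eq:
  assumes "p \<in> imag_units" "q \<in> imag_units"
  shows "quat_wedge p q = p * q + of_real (p \<bullet> q)"
  using assms unfolding imag_units_iff
  by (simp add: quat_eq_iff quat_wedge_def vec_quat_def quat_vec_def cross3_def inner_quat_def)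

lemma slice_plane_scaleR:
  assumes "r \<noteq> 0"
  shows "slice_plane (r *\<^sub>R I) = slice_plane I"
proof -
  have "q \<in> slice_plane (r *\<^sub>R I) \<longleftrightarrow> q \<in> slice_plane I" for q
  proof
    assume "q \<in> slice_plane (r *\<^sub>R I)"
    then obtain x y where "q = of_real x + r *\<^sub>R I * of_real y" unfolding slice_plane_iff by blast
    then have "q = of_real x + I * of_real (r * y)" by (simp add: of_real_def)
    then show "q \<in> slice_plane I" unfolding slice_plane_iff by blast
  next
    assume "q \<in> slice_plane I"
    then obtain x y where "q = of_real x + I * of_real y" unfolding slice_plane_iff by blast
    then have "q = of_real x + r *\<^sub>R I * of_real (y / r)" using assms by (simp add: of_real_def)
    then show "q \<in> slice_plane (r *\<^sub>R I)" unfolding slice_plane_iff by blast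
  qed
  then show ?thesis by blast
qed

lemma slice_plane_eqD:
  assumes "I \<in> imag_units" "M \<in> imag_units" "slice_plane I = slice_plane M"
  obtains a :: real where "a\<^sup>2 = 1" "M = a *\<^sub>R I"
proof -
  have "M \<in> slice_plane I" unfolding assms(3) by (simp add: slice_plane_def span_base)
  then obtain x y where M: "M = of_real x + I * of_real y" unfolding slice_plane_iff by blast
  have "x = 0" using assms(1,2) qre_slice[OF assms(1), of x y] unfolding M[symmetric] imag_units_iff by simp
  then have M': "M = y *\<^sub>R I" using M by (simp add: of_real_def)
  then have "\<bar>y\<bar> = 1" using assms(1,2) unfolding imag_units_iff by simp
  then have "y\<^sup>2 = 1" by (simp add: power2_eq_1_iff abs_if split: if_splits)
  then show thesis using M' by (rule that)
qed

text \<open>K is the unit normal to the plane of I and M, and K I is the normalized part of M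
  orthogonal to I. The coordinates of M are the cosine and the sine of its angle with I, the sine
  being nonzero because the slice planes differ.\<close>

lemma quat_wedge_frame:
  assumes I: "I \<in> imag_units" and M: "M \<in> imag_units" and ne: "slice_plane I \<noteq> slice_plane M"
  defines "K \<equiv> quat_wedge I M /\<^sub>R norm (quat_wedge I M)"
  shows "quat_frame I (K * I) K"
    and "norm (quat_wedge I M) > 0"
    and "(I \<bullet> M)\<^sup>2 + (norm (quat_wedge I M))\<^sup>2 = 1"
    and "M = (I \<bullet> M) *\<^sub>R I + norm (quat_wedge I M) *\<^sub>R (K * I)"
proof -
  let ?W = "quat_wedge I M" and ?A = "I \<bullet> M"
  let ?B = "norm ?W"
  have re: "qre I = 0" "qre M = 0" "I \<bullet> I = 1" "M \<bullet> M = 1"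
    using I M by (simp_all add: imag_units_iff norm_eq_1)
  have W: "?W = I * M + of_real ?A" by (rule quat_wedge_eq[OF I M])
  have IW: "I * ?W = ?A *\<^sub>R I - M"
    unfolding W distrib_left by (simp add: imag_unit_square[OF I] of_real_def flip: mult.assoc)
  show B: "?B > 0"
  proof (rule ccontr)
    assume "\<not> ?B > 0"
    then have "M = ?A *\<^sub>R I" using IW by simp
    moreover from this have "?A \<noteq> 0" using re(4) by (metis inner_zero_left scaleR_zero_left zero_neq_one)
    ultimately show False using ne slice_plane_scaleR by metis
  qed
  have ii: "qim1 I * qim1 I + qim2 I * qim2 I + qim3 I * qim3 I = 1"
    "qim1 M * qim1 M + qim2 M * qim2 M + qim3 M * qim3 M = 1"
    using re by (simp_all add: inner_quat_def)
  have WI: "?W * I = M - ?A *\<^sub>R I"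
  proof -
    have "?W * I = - (I * ?W)"
      unfolding W by (simp add: quat_eq_iff inner_quat_def re algebra_simps)
    then show ?thesis by (simp add: IW)
  qed
  have KI: "K * I = (M - ?A *\<^sub>R I) /\<^sub>R ?B" by (simp add: K_def WI)
  then show "M = ?A *\<^sub>R I + ?B *\<^sub>R (K * I)" using B by simp
  \<comment> \<open>The unit quaternion I M has real part - (I \<bullet> M) and the wedge as vector
    part.\<close>
  show AB: "?A\<^sup>2 + ?B\<^sup>2 = 1"
    unfolding power2_norm_eq_inner W using ii
    by (simp add: inner_quat_def re) algebra
  have "(M - ?A *\<^sub>R I) \<bullet> (M - ?A *\<^sub>R I) = 1 - ?A\<^sup>2"
    by (simp add: inner_diff_left inner_diff_right re inner_commute power2_eq_square)
  then have "(norm (M - ?A *\<^sub>R I))\<^sup>2 = ?B\<^sup>2"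
    using AB by (simp add: power2_norm_eq_inner)
  then have nrm: "norm (M - ?A *\<^sub>R I) = ?B" by (simp add: power2_eq_iff_nonneg)
  show "quat_frame I (K * I) K"
  proof
    show "K * I \<in> imag_units" unfolding KI using B nrm by (simp add: imag_units_iff re)
    show "I \<bullet> (K * I) = 0" unfolding KI by (simp add: inner_diff_right re)
    show "K = I * (K * I)"
    proof -
      have "I * (?W * I) = ?W"
        unfolding WI by (simp add: right_diff_distrib imag_unit_square[OF I] W of_real_def)
      then show ?thesis by (simp add: K_def)
    qed
  qed (rule I)
qed

section \<open>The conjugated function in a frame\<close>

text \<open>In complex form the hypotheses read (s + t i)^2 (x + y i) = (s^2 + t^2) m. Multiplying
  by (s - t i)^2 gives (s^2 + t^2)^2 (x + y i) = (s^2 + t^2) m (s - t i)^2, and one factor s^2 + t^2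
  cancels; if it is 0, then s = t = 0 and the claims are trivial. The factor - 1 / 2 matches the
  coefficient -2 of K0 in the theorem.\<close>

lemma solve_rotation:
  fixes s t m x y :: real
  assumes "2 * s * t * x + (s\<^sup>2 - t\<^sup>2) * y = 0" "(s\<^sup>2 + t\<^sup>2) * m = (s\<^sup>2 - t\<^sup>2) * x - 2 * s * t * y"
  shows "m * (s\<^sup>2 - t\<^sup>2) = (s\<^sup>2 + t\<^sup>2) * x" "m * s * t = (s\<^sup>2 + t\<^sup>2) * ((- 1 / 2) * y)"
proof -
  have *: "(s\<^sup>2 + t\<^sup>2) * (m * (s\<^sup>2 - t\<^sup>2)) = (s\<^sup>2 + t\<^sup>2) * ((s\<^sup>2 + t\<^sup>2) * x)"
    "(s\<^sup>2 + t\<^sup>2) * (2 * (m * s * t)) = (s\<^sup>2 + t\<^sup>2) * (- ((s\<^sup>2 + t\<^sup>2) * y))"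
    using assms by algebra+
  have "m * (s\<^sup>2 - t\<^sup>2) = (s\<^sup>2 + t\<^sup>2) * x \<and> 2 * (m * s * t) = - ((s\<^sup>2 + t\<^sup>2) * y)"
  proof (cases "s\<^sup>2 + t\<^sup>2 = 0")
    case True
    then show ?thesis by (simp add: sum_power2_eq_zero_iff)
  next
    case False
    with * show ?thesis by (metis mult_left_cancel)
  qed
  then show "m * (s\<^sup>2 - t\<^sup>2) = (s\<^sup>2 + t\<^sup>2) * x" "m * s * t = (s\<^sup>2 + t\<^sup>2) * ((- 1 / 2) * y)"
    by simp_all
qed

text \<open>M0 is left out because J is chosen differently in each case: J = M0 if it is orthogonal
  to I, arbitrary if M0 is parallel to I, and the normalized orthogonal part of M0
  otherwise.\<close>

locale conjugation_frame = quat_frame I J K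
  for I J K +
  fixes \<Omega> :: "quat set" and h h0 h1 f :: "quat \<Rightarrow> quat"
  assumes dom: "symmetric_slice_domain \<Omega>"
    and h0: "h0 \<in> slice_preserving \<Omega>" and h1: "h1 \<in> slice_preserving \<Omega>"
    and h: "h \<in> slice_regular \<Omega>" and h_nonpreserving: "h \<notin> slice_preserving \<Omega>"
    and h_eq: "\<And>q. q \<in> \<Omega> \<Longrightarrow> h q = h0 q + h1 q * I"
    and f: "f \<in> slice_regular \<Omega>"
begin

definition s where "s x = qre (h0 (of_real x))"
definition t where "t x = qre (h1 (of_real x))"
abbreviation hs where "hs \<equiv> symmetrized \<Omega> h"
abbreviation hfh where "hfh \<equiv> star_prod \<Omega> (star_prod \<Omega> h f) (regular_conj \<Omega> h)"
abbreviation fr where "fr x \<equiv> f (of_real x)"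

lemma h_real:
  assumes "of_real x \<in> \<Omega>"
  shows "h (of_real x) = of_real (s x) + t x *\<^sub>R I"
  using h_eq[OF assms] slice_preserving_of_real[OF h0 assms] slice_preserving_of_real[OF h1 assms]
  unfolding s_def t_def by (metis scaleR_conv_of_real)

lemma hs: "hs \<in> slice_preserving \<Omega>"
  by (rule symmetrized_preserving(1)[OF dom h])

lemma hs_real:
  assumes "of_real x \<in> \<Omega>"
  shows "hs (of_real x) = of_real ((s x)\<^sup>2 + (t x)\<^sup>2)"
proof -
  have "h (of_real x) \<bullet> h (of_real x) = (s x)\<^sup>2 + (t x)\<^sup>2"
    unfolding h_real[OF assms] using coordinates(1)
    by (simp add: inner_quat_def re power2_eq_square) algebra
  then show ?thesis using symmetrized_preserving(2)[OF dom h assms] by simp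
qed

text \<open>On the real axis \<open>hs\<close> is s^2 + t^2. If it vanished, so would t, and h would
  agree with the slice preserving h0.\<close>

lemma hs_nonzero: "\<exists>p\<in>\<Omega>. hs p \<noteq> 0"
proof (rule ccontr)
  assume "\<not> (\<exists>p\<in>\<Omega>. hs p \<noteq> 0)"
  then have t0: "t x = 0" if "of_real x \<in> \<Omega>" for x
    using hs_real[OF that] that by (metis of_real_eq_0_iff sum_power2_eq_zero_iff)
  have "h q = h0 q" if "q \<in> \<Omega>" for q
    by (rule slice_regular_eqI[OF dom h slice_preserving_regular[OF h0] _ that])
      (metis add.right_neutral h_real t0 scaleR_zero_left slice_preserving_of_real[OF h0] s_def)
  then have "h \<in> slice_preserving \<Omega>"
    using slice_preserving_cong[OF _ _ h0, of h] dom unfolding symmetric_slice_domain_def by auto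
  then show False using h_nonpreserving by blast
qed

lemma hfh_iff:
  assumes ab: "a\<^sup>2 + b\<^sup>2 = 1"
  shows "hfh \<in> slice_regular_on \<Omega> (a *\<^sub>R I + b *\<^sub>R J) \<longleftrightarrow>
    (\<forall>x. of_real x \<in> \<Omega> \<longrightarrow>
      2 * s x * t x * (fr x \<bullet> J) + ((s x)\<^sup>2 - (t x)\<^sup>2) * (fr x \<bullet> K) = 0 \<and>
      a * (((s x)\<^sup>2 - (t x)\<^sup>2) * (fr x \<bullet> J) - 2 * s x * t x * (fr x \<bullet> K)) =
        b * (((s x)\<^sup>2 + (t x)\<^sup>2) * (fr x \<bullet> I)))"
proof -
  have "norm (a *\<^sub>R I + b *\<^sub>R J) = 1"
    unfolding norm_eq_1 using ab
    by (simp add: inner_add_left inner_add_right inner_frame power2_eq_square)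
  then have M: "a *\<^sub>R I + b *\<^sub>R J \<in> imag_units" by (simp add: imag_units_iff re)
  note hf = star_prod_regular[OF dom h f]
  note hc = regular_conj_regular[OF dom h]
  note hfh = star_prod_regular[OF dom hf(1) hc(1)]
  have v: "hfh (of_real x) = (of_real (s x) + t x *\<^sub>R I) * fr x * quat_cnj (of_real (s x) + t x *\<^sub>R I)"
    if "of_real x \<in> \<Omega>" for x
    using hfh(2)[OF that] hf(2)[OF that] hc(2)[OF that] h_real[OF that] by simp
  show ?thesis
    unfolding slice_regular_on_iff[OF dom hfh(1) M]
    using v conj_in_slice_plane_iff[OF ab] by (metis (no_types, lifting))
qed

section \<open>Divisibility and quotients tested on the real axis\<close>

lemma slice_quotI:
  assumes "\<sigma> \<in> slice_preserving \<Omega>" "\<tau> \<in> slice_preserving \<Omega>" "\<kappa> \<in> slice_preserving \<Omega>"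
    and "\<And>x. of_real x \<in> \<Omega> \<Longrightarrow> \<tau> (of_real x) = \<sigma> (of_real x) * \<kappa> (of_real x)"
  shows "is_slice_quot \<Omega> \<tau> \<sigma> \<kappa>"
  using slice_regular_eqI[OF dom slice_preserving_regular[OF assms(2)]
      slice_preserving_regular[OF slice_preserving_mult[OF assms(1,3)]] assms(4)] assms(3)
  unfolding is_slice_quot_def by blast

lemma slice_quot_unique:
  assumes "is_slice_quot \<Omega> \<tau> hs \<kappa>" "q \<in> \<Omega>"
  shows "slice_quot \<Omega> \<tau> hs q = \<kappa> q"
  using hs_nonzero slice_quot_eq[OF dom hs _ _ assms] by blast

lemma hs2: "(\<lambda>q. (hs q)\<^sup>2) \<in> slice_preserving \<Omega>"
  using slice_preserving_mult[OF hs hs] by (simp add: power2_eq_square)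

lemma slice_quot_unique2:
  assumes "is_slice_quot \<Omega> \<tau> (\<lambda>q. (hs q)\<^sup>2) \<kappa>" "q \<in> \<Omega>"
  shows "slice_quot \<Omega> \<tau> (\<lambda>q. (hs q)\<^sup>2) q = \<kappa> q"
proof -
  obtain p where "p \<in> \<Omega>" "(hs p)\<^sup>2 \<noteq> 0" using hs_nonzero by auto
  then show ?thesis by (rule slice_quot_eq[OF dom hs2 _ _ assms])
qed

lemma sq_diff: "(\<lambda>q. (h0 q)\<^sup>2 - (h1 q)\<^sup>2) \<in> slice_preserving \<Omega>"
  using slice_preserving_diff[OF slice_preserving_mult[OF h0 h0] slice_preserving_mult[OF h1 h1]]
  by (simp add: power2_eq_square)

lemma real_values:
  assumes "of_real x \<in> \<Omega>"
  shows "h0 (of_real x) = of_real (s x)" "h1 (of_real x) = of_real (t x)"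
    "hs (of_real x) = of_real ((s x)\<^sup>2 + (t x)\<^sup>2)"
  using slice_preserving_of_real[OF h0 assms] slice_preserving_of_real[OF h1 assms]
    hs_real[OF assms] by (simp_all only: s_def t_def)

text \<open>Here b = 0, and \<open>hfh_iff\<close> says (s + t I)^2 (v2 + v3 I) = 0 for the
  coordinates v2, v3 of f along J and K. Multiplying by (s - t I)^2 isolates (s^2 + t^2)^2 v2 and
  (s^2 + t^2)^2 v3, and \<open>hs\<close> is not identically 0.\<close>

lemma parallel:
  assumes "a\<^sup>2 = 1" and "hfh \<in> slice_regular_on \<Omega> (a *\<^sub>R I)"
  shows "f \<in> slice_regular_on \<Omega> I"
proof -
  have "hfh \<in> slice_regular_on \<Omega> (a *\<^sub>R I + 0 *\<^sub>R J)" using assms(2) by simp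
  moreover have "a\<^sup>2 + 0\<^sup>2 = 1" "a \<noteq> 0" using assms(1) by auto
  ultimately have e: "2 * s x * t x * (fr x \<bullet> J) + ((s x)\<^sup>2 - (t x)\<^sup>2) * (fr x \<bullet> K) = 0"
      "((s x)\<^sup>2 - (t x)\<^sup>2) * (fr x \<bullet> J) - 2 * s x * t x * (fr x \<bullet> K) = 0" if "of_real x \<in> \<Omega>" for x
    using hfh_iff[of a 0] that by auto
  have vanish: "fr x \<bullet> u = 0"
    if u: "\<And>x. of_real x \<in> \<Omega> \<Longrightarrow> ((s x)\<^sup>2 + (t x)\<^sup>2)\<^sup>2 * (fr x \<bullet> u) = 0" and x: "of_real x \<in> \<Omega>" for u x
  proof -
    obtain v where v: "v \<in> slice_preserving \<Omega>"
      "\<forall>x. of_real x \<in> \<Omega> \<longrightarrow> v (of_real x) = of_real (fr x \<bullet> u)"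
      by (rule slice_preserving_inner_component[OF dom f])
    obtain p where p: "p \<in> \<Omega>" "hs p \<noteq> 0" using hs_nonzero by blast
    have "v (of_real x) = 0"
    proof (rule slice_preserving_mult_eq_0[OF dom hs slice_preserving_regular[OF v(1)] p _ x])
      fix x assume x: "of_real x \<in> \<Omega>"
      have "((s x)\<^sup>2 + (t x)\<^sup>2) * (fr x \<bullet> u) = 0" using u[OF x] by auto
      then show "hs (of_real x) * v (of_real x) = 0"
        unfolding hs_real[OF x] v(2)[rule_format, OF x] of_real_mult[symmetric]
        by (simp only: of_real_0)
    qed
    then show ?thesis using v(2) x by simp
  qed
  have "((s x)\<^sup>2 + (t x)\<^sup>2)\<^sup>2 * (fr x \<bullet> J) = 0" if "of_real x \<in> \<Omega>" for x
    using e[OF that] by algebra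
  then have J0: "fr x \<bullet> J = 0" if "of_real x \<in> \<Omega>" for x
    using vanish that by blast
  have "((s x)\<^sup>2 + (t x)\<^sup>2)\<^sup>2 * (fr x \<bullet> K) = 0" if "of_real x \<in> \<Omega>" for x
    using e[OF that] by algebra
  then have K0: "fr x \<bullet> K = 0" if "of_real x \<in> \<Omega>" for x
    using vanish that by blast
  have "1\<^sup>2 + 0\<^sup>2 = (1 :: real)" by simp
  from slice_plane_iff_inner[OF this] have "fr x \<in> slice_plane I" if "of_real x \<in> \<Omega>" for x
    using J0[OF that] K0[OF that] by simp
  then show ?thesis by (simp add: slice_regular_on_iff[OF dom f I])
qed

lemma inner_frame_combination:
  "(of_real r + x *\<^sub>R I + y *\<^sub>R J + z *\<^sub>R K) \<bullet> I = x"
  "(of_real r + x *\<^sub>R I + y *\<^sub>R J + z *\<^sub>R K) \<bullet> J = y"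
  "(of_real r + x *\<^sub>R I + y *\<^sub>R J + z *\<^sub>R K) \<bullet> K = z"
  by (simp_all add: inner_add_left inner_frame)

text \<open>For a = 0 and b = 1 the equations force the I-coordinate of f to vanish and leave the
  conjugated function without K-coordinate. Its J-coordinate is the \<rho> sought, and conjugating
  back divides by \<open>hs\<close> twice.\<close>

lemma orthogonal_iff:
  assumes f0: "\<forall>q\<in>\<Omega>. f0 q = slice_real_part \<Omega> f q"
  shows "hfh \<in> slice_regular_on \<Omega> J \<longleftrightarrow>
    (\<exists>\<rho>\<in>slice_preserving \<Omega>.
      slice_dvd \<Omega> (\<lambda>q. (hs q)\<^sup>2) (\<lambda>q. \<rho> q * ((h0 q)\<^sup>2 - (h1 q)\<^sup>2)) \<and>
      slice_dvd \<Omega> (\<lambda>q. (hs q)\<^sup>2) (\<lambda>q. \<rho> q * h0 q * h1 q) \<and>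
      (\<forall>q\<in>\<Omega>. f q = f0 q
         + slice_quot \<Omega> (\<lambda>q. \<rho> q * ((h0 q)\<^sup>2 - (h1 q)\<^sup>2)) (\<lambda>q. (hs q)\<^sup>2) q * J
         - 2 * slice_quot \<Omega> (\<lambda>q. \<rho> q * h0 q * h1 q) (\<lambda>q. (hs q)\<^sup>2) q * K))"
    (is "_ \<longleftrightarrow> ?R")
proof -
  note fr0 = slice_real_part_preserving[OF dom f]
  have "0\<^sup>2 + 1\<^sup>2 = (1 :: real)" by simp
  from hfh_iff[OF this] have iff: "hfh \<in> slice_regular_on \<Omega> J \<longleftrightarrow>
    (\<forall>x. of_real x \<in> \<Omega> \<longrightarrow>
      2 * s x * t x * (fr x \<bullet> J) + ((s x)\<^sup>2 - (t x)\<^sup>2) * (fr x \<bullet> K) = 0 \<and>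
      ((s x)\<^sup>2 + (t x)\<^sup>2) * (fr x \<bullet> I) = 0)" by (simp add: eq_commute[of 0])
  show ?thesis
  proof
    assume "hfh \<in> slice_regular_on \<Omega> J"
    then have e: "2 * s x * t x * (fr x \<bullet> J) + ((s x)\<^sup>2 - (t x)\<^sup>2) * (fr x \<bullet> K) = 0"
      "((s x)\<^sup>2 + (t x)\<^sup>2) * (fr x \<bullet> I) = 0" if "of_real x \<in> \<Omega>" for x
      using iff that by blast+
    obtain v1 where v1: "v1 \<in> slice_preserving \<Omega>"
      "\<forall>x. of_real x \<in> \<Omega> \<longrightarrow> v1 (of_real x) = of_real (fr x \<bullet> I)"
      by (rule slice_preserving_inner_component[OF dom f])
    obtain v2 where v2: "v2 \<in> slice_preserving \<Omega>"
      "\<forall>x. of_real x \<in> \<Omega> \<longrightarrow> v2 (of_real x) = of_real (fr x \<bullet> J)"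
      by (rule slice_preserving_inner_component[OF dom f])
    obtain v3 where v3: "v3 \<in> slice_preserving \<Omega>"
      "\<forall>x. of_real x \<in> \<Omega> \<longrightarrow> v3 (of_real x) = of_real (fr x \<bullet> K)"
      by (rule slice_preserving_inner_component[OF dom f])
    obtain p where p: "p \<in> \<Omega>" "hs p \<noteq> 0" using hs_nonzero by blast
    have "v1 (of_real x) = 0" if x: "of_real x \<in> \<Omega>" for x
    proof (rule slice_preserving_mult_eq_0[OF dom hs slice_preserving_regular[OF v1(1)] p _ x])
      fix x assume x: "of_real x \<in> \<Omega>"
      show "hs (of_real x) * v1 (of_real x) = 0"
        unfolding hs_real[OF x] v1(2)[rule_format, OF x] of_real_mult[symmetric] e(2)[OF x]
        by (simp only: of_real_0)
    qed
    then have v1_0: "fr x \<bullet> I = 0" if "of_real x \<in> \<Omega>" for x using v1(2) that by simp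
    \<comment> \<open>The J-coordinate of the conjugated function, as in
      \<open>conj_expand\<close>.\<close>
    define \<rho> where "\<rho> = (\<lambda>q. ((h0 q)\<^sup>2 - (h1 q)\<^sup>2) * v2 q - 2 *\<^sub>R (h0 q * h1 q * v3 q))"
    have \<rho>: "\<rho> \<in> slice_preserving \<Omega>"
      unfolding \<rho>_def
      by (rule slice_preserving_diff[OF slice_preserving_mult[OF sq_diff v2(1)] slice_preserving_scaleR[OF
          slice_preserving_mult[OF slice_preserving_mult[OF h0 h1] v3(1)]]])
    have \<rho>x: "\<rho> (of_real x) =
      of_real (((s x)\<^sup>2 - (t x)\<^sup>2) * (fr x \<bullet> J) - 2 * (s x * t x * (fr x \<bullet> K)))" if "of_real x \<in> \<Omega>" for x
      unfolding \<rho>_def real_values[OF that] v2(2)[rule_format, OF that] v3(2)[rule_format, OF that]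
      by (simp add: scaleR_conv_of_real)
    have q1: "is_slice_quot \<Omega> (\<lambda>q. \<rho> q * ((h0 q)\<^sup>2 - (h1 q)\<^sup>2)) (\<lambda>q. (hs q)\<^sup>2) v2"
    proof (rule slice_quotI[OF hs2 slice_preserving_mult[OF \<rho> sq_diff] v2(1)])
      fix x assume x: "of_real x \<in> \<Omega>"
      \<comment> \<open>Eliminating with the first equation leaves the coefficient (s^2 - t^2)^2 +
        (2 s t)^2 = (s^2 + t^2)^2.\<close>
      have "(((s x)\<^sup>2 - (t x)\<^sup>2) * (fr x \<bullet> J) - 2 * (s x * t x * (fr x \<bullet> K))) * ((s x)\<^sup>2 - (t x)\<^sup>2) =
        ((s x)\<^sup>2 + (t x)\<^sup>2)\<^sup>2 * (fr x \<bullet> J)" using e(1)[OF x] by algebra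
      from arg_cong[OF this, of "of_real :: real \<Rightarrow> quat"]
      show "\<rho> (of_real x) * ((h0 (of_real x))\<^sup>2 - (h1 (of_real x))\<^sup>2) = (hs (of_real x))\<^sup>2 * v2 (of_real x)"
        unfolding \<rho>x[OF x] real_values[OF x] v2(2)[rule_format, OF x]
        by (simp only: of_real_mult of_real_diff of_real_power)
    qed
    \<comment> \<open>The quotient is minus half the K-coordinate, since the formula for f carries
      the coefficient -2.\<close>
    have q2: "is_slice_quot \<Omega> (\<lambda>q. \<rho> q * h0 q * h1 q) (\<lambda>q. (hs q)\<^sup>2) (\<lambda>q. (- 1 / 2) *\<^sub>R v3 q)"
    proof (rule slice_quotI[OF hs2 slice_preserving_mult[OF slice_preserving_mult[OF \<rho> h0] h1]
          slice_preserving_scaleR[OF v3(1)]])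
      fix x assume x: "of_real x \<in> \<Omega>"
      have "2 * ((((s x)\<^sup>2 - (t x)\<^sup>2) * (fr x \<bullet> J) - 2 * (s x * t x * (fr x \<bullet> K))) * s x * t x) =
        - (((s x)\<^sup>2 + (t x)\<^sup>2)\<^sup>2 * (fr x \<bullet> K))" using e(1)[OF x] by algebra
      then have "(((s x)\<^sup>2 - (t x)\<^sup>2) * (fr x \<bullet> J) - 2 * (s x * t x * (fr x \<bullet> K))) * s x * t x =
        ((s x)\<^sup>2 + (t x)\<^sup>2)\<^sup>2 * ((- 1 / 2) * (fr x \<bullet> K))" by simp
      from arg_cong[OF this, of "of_real :: real \<Rightarrow> quat"]
      show "\<rho> (of_real x) * h0 (of_real x) * h1 (of_real x) =
          (hs (of_real x))\<^sup>2 * ((- 1 / 2) *\<^sub>R v3 (of_real x))"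
        unfolding \<rho>x[OF x] real_values[OF x] v3(2)[rule_format, OF x] scaleR_conv_of_real
        by (simp only: of_real_mult of_real_diff of_real_power)
    qed
    have r: "(\<lambda>q. slice_real_part \<Omega> f q + v2 q * J + v3 q * K) \<in> slice_regular \<Omega>"
      by (intro slice_regular_add slice_regular_mult_const slice_preserving_regular fr0(1) v2(1) v3(1))
    have "fr x = slice_real_part \<Omega> f (of_real x) + v2 (of_real x) * J + v3 (of_real x) * K"
      if x: "of_real x \<in> \<Omega>" for x
      using expand[of "fr x"] v1_0[OF x]
      unfolding fr0(2)[OF x] v2(2)[rule_format, OF x] v3(2)[rule_format, OF x]
      by (simp add: scaleR_conv_of_real)
    then have feq: "f q = slice_real_part \<Omega> f q + v2 q * J + v3 q * K" if "q \<in> \<Omega>" for q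
      using slice_regular_eqI[OF dom f r _ that] by blast
    show ?R
    proof (intro bexI[OF _ \<rho>] conjI ballI)
      fix q assume q: "q \<in> \<Omega>"
      have m: "2 * ((- 1 / 2) *\<^sub>R v) = - v" for v :: quat
        unfolding mult_2 scaleR_left_distrib[symmetric] by simp
      show "f q = f0 q
         + slice_quot \<Omega> (\<lambda>q. \<rho> q * ((h0 q)\<^sup>2 - (h1 q)\<^sup>2)) (\<lambda>q. (hs q)\<^sup>2) q * J
         - 2 * slice_quot \<Omega> (\<lambda>q. \<rho> q * h0 q * h1 q) (\<lambda>q. (hs q)\<^sup>2) q * K"
        unfolding slice_quot_unique2[OF q1 q] slice_quot_unique2[OF q2 q] f0[rule_format, OF q] m
        using feq[OF q] by simp
    qed (use q1 q2 in \<open>auto simp: slice_dvd_def\<close>)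
  next
    assume ?R
    then obtain \<rho> k1 k2 where \<rho>: "\<rho> \<in> slice_preserving \<Omega>"
      and q1: "is_slice_quot \<Omega> (\<lambda>q. \<rho> q * ((h0 q)\<^sup>2 - (h1 q)\<^sup>2)) (\<lambda>q. (hs q)\<^sup>2) k1"
      and q2: "is_slice_quot \<Omega> (\<lambda>q. \<rho> q * h0 q * h1 q) (\<lambda>q. (hs q)\<^sup>2) k2"
      and feq: "\<And>q. q \<in> \<Omega> \<Longrightarrow> f q = f0 q
         + slice_quot \<Omega> (\<lambda>q. \<rho> q * ((h0 q)\<^sup>2 - (h1 q)\<^sup>2)) (\<lambda>q. (hs q)\<^sup>2) q * J
         - 2 * slice_quot \<Omega> (\<lambda>q. \<rho> q * h0 q * h1 q) (\<lambda>q. (hs q)\<^sup>2) q * K"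
      unfolding slice_dvd_def by blast
    show "hfh \<in> slice_regular_on \<Omega> J"
      unfolding iff
    proof (intro allI impI)
      fix x assume x: "of_real x \<in> \<Omega>"
      obtain r where r: "\<rho> (of_real x) = of_real r" using slice_preserving_of_real[OF \<rho> x] by blast
      obtain c1 where c1: "k1 (of_real x) = of_real c1"
        using slice_preserving_of_real[OF _ x] q1 unfolding is_slice_quot_def by blast
      obtain c2 where c2: "k2 (of_real x) = of_real c2"
        using slice_preserving_of_real[OF _ x] q2 unfolding is_slice_quot_def by blast
      have "\<rho> (of_real x) * ((h0 (of_real x))\<^sup>2 - (h1 (of_real x))\<^sup>2) = (hs (of_real x))\<^sup>2 * k1 (of_real x)"
        using q1 x unfolding is_slice_quot_def by blast
      then have "(of_real (r * ((s x)\<^sup>2 - (t x)\<^sup>2)) :: quat) = of_real (((s x)\<^sup>2 + (t x)\<^sup>2)\<^sup>2 * c1)"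
        unfolding r c1 real_values[OF x] by (simp only: of_real_mult of_real_diff of_real_power)
      then have e1: "r * ((s x)\<^sup>2 - (t x)\<^sup>2) = ((s x)\<^sup>2 + (t x)\<^sup>2)\<^sup>2 * c1" by (simp only: of_real_eq_iff)
      have "\<rho> (of_real x) * h0 (of_real x) * h1 (of_real x) = (hs (of_real x))\<^sup>2 * k2 (of_real x)"
        using q2 x unfolding is_slice_quot_def by blast
      then have "(of_real (r * s x * t x) :: quat) = of_real (((s x)\<^sup>2 + (t x)\<^sup>2)\<^sup>2 * c2)"
        unfolding r c2 real_values[OF x] by (simp only: of_real_mult of_real_diff of_real_power)
      then have e2: "r * s x * t x = ((s x)\<^sup>2 + (t x)\<^sup>2)\<^sup>2 * c2" by (simp only: of_real_eq_iff)
      have "fr x = of_real (qre (fr x)) + of_real c1 * J - 2 * of_real c2 * K"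
        using feq[OF x] unfolding slice_quot_unique2[OF q1 x] slice_quot_unique2[OF q2 x] f0[rule_format, OF x]
          fr0(2)[OF x] c1 c2 .
      also have "\<dots> = of_real (qre (fr x)) + 0 *\<^sub>R I + c1 *\<^sub>R J + (- 2 * c2) *\<^sub>R K"
        by (simp add: scaleR_conv_of_real)
      finally have v: "fr x \<bullet> I = 0" "fr x \<bullet> J = c1" "fr x \<bullet> K = - 2 * c2"
        using inner_frame_combination by metis+
      show "2 * s x * t x * (fr x \<bullet> J) + ((s x)\<^sup>2 - (t x)\<^sup>2) * (fr x \<bullet> K) = 0 \<and>
        ((s x)\<^sup>2 + (t x)\<^sup>2) * (fr x \<bullet> I) = 0"
      \<comment> \<open>Where s^2 + t^2 = 0 the quotient relations carry no information, but s and t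
        vanish and both equations are trivial; elsewhere the factor is cancelled.\<close>
      proof (cases "(s x)\<^sup>2 + (t x)\<^sup>2 = 0")
        case True
        then show ?thesis using v by (simp add: sum_power2_eq_zero_iff)
      next
        case False
        have "((s x)\<^sup>2 + (t x)\<^sup>2)\<^sup>2 * (2 * s x * t x * c1 + ((s x)\<^sup>2 - (t x)\<^sup>2) * (- 2 * c2)) = 0"
          using e1 e2 by algebra
        then have "2 * s x * t x * c1 + ((s x)\<^sup>2 - (t x)\<^sup>2) * (- 2 * c2) = 0"
          using False by (metis mult_eq_0_iff power_not_zero)
        then show ?thesis unfolding v by simp
      qed
    qed
  qed
qed

text \<open>As a is nonzero, \<rho> can be read off from the coordinate a \<rho> of f along I, and
  the second equation makes b \<rho> \<open>hs\<close> the J-coordinate of the conjugated function.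
  Undoing the rotation with \<open>solve_rotation\<close> leaves a single \<open>hs\<close> in the
  denominators.\<close>

lemma oblique_iff:
  assumes f0: "\<forall>q\<in>\<Omega>. f0 q = slice_real_part \<Omega> f q"
    and ab: "a\<^sup>2 + b\<^sup>2 = 1" "a \<noteq> 0" "b \<noteq> 0"
  shows "hfh \<in> slice_regular_on \<Omega> (a *\<^sub>R I + b *\<^sub>R J) \<longleftrightarrow>
    (\<exists>\<rho>\<in>slice_preserving \<Omega>.
      slice_dvd \<Omega> hs (\<lambda>q. \<rho> q * ((h0 q)\<^sup>2 - (h1 q)\<^sup>2)) \<and>
      slice_dvd \<Omega> hs (\<lambda>q. h0 q * h1 q * \<rho> q) \<and>
      (\<forall>q\<in>\<Omega>. f q = f0 q
         + a *\<^sub>R \<rho> q * I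
         + slice_quot \<Omega> (\<lambda>q. b *\<^sub>R \<rho> q * ((h0 q)\<^sup>2 - (h1 q)\<^sup>2)) hs q * J
         - 2 * slice_quot \<Omega> (\<lambda>q. b *\<^sub>R \<rho> q * h0 q * h1 q) hs q * K))"
    (is "_ \<longleftrightarrow> ?R")
proof -
  note fr0 = slice_real_part_preserving[OF dom f]
  note iff = hfh_iff[OF ab(1)]
  show ?thesis
  proof
    assume "hfh \<in> slice_regular_on \<Omega> (a *\<^sub>R I + b *\<^sub>R J)"
    then have e: "2 * s x * t x * (fr x \<bullet> J) + ((s x)\<^sup>2 - (t x)\<^sup>2) * (fr x \<bullet> K) = 0"
      "a * (((s x)\<^sup>2 - (t x)\<^sup>2) * (fr x \<bullet> J) - 2 * s x * t x * (fr x \<bullet> K)) =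
        b * (((s x)\<^sup>2 + (t x)\<^sup>2) * (fr x \<bullet> I))" if "of_real x \<in> \<Omega>" for x
      using iff that by blast+
    obtain v1 where v1: "v1 \<in> slice_preserving \<Omega>"
      "\<forall>x. of_real x \<in> \<Omega> \<longrightarrow> v1 (of_real x) = of_real (fr x \<bullet> I)"
      by (rule slice_preserving_inner_component[OF dom f])
    obtain v2 where v2: "v2 \<in> slice_preserving \<Omega>"
      "\<forall>x. of_real x \<in> \<Omega> \<longrightarrow> v2 (of_real x) = of_real (fr x \<bullet> J)"
      by (rule slice_preserving_inner_component[OF dom f])
    obtain v3 where v3: "v3 \<in> slice_preserving \<Omega>"
      "\<forall>x. of_real x \<in> \<Omega> \<longrightarrow> v3 (of_real x) = of_real (fr x \<bullet> K)"
      by (rule slice_preserving_inner_component[OF dom f])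
    define \<rho> where "\<rho> = (\<lambda>q. (1 / a) *\<^sub>R v1 q)"
    have \<rho>: "\<rho> \<in> slice_preserving \<Omega>"
      unfolding \<rho>_def by (intro slice_preserving_scaleR v1(1))
    have \<rho>x: "\<rho> (of_real x) = of_real ((1 / a) * (fr x \<bullet> I))" if "of_real x \<in> \<Omega>" for x
      unfolding \<rho>_def v1(2)[rule_format, OF that] by (simp only: scaleR_conv_of_real of_real_mult)
    have b\<rho>: "(\<lambda>q. b *\<^sub>R \<rho> q) \<in> slice_preserving \<Omega>" by (rule slice_preserving_scaleR[OF \<rho>])
    have key: "(b * ((1 / a) * (fr x \<bullet> I))) * ((s x)\<^sup>2 - (t x)\<^sup>2) = ((s x)\<^sup>2 + (t x)\<^sup>2) * (fr x \<bullet> J)"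
      "(b * ((1 / a) * (fr x \<bullet> I))) * s x * t x = ((s x)\<^sup>2 + (t x)\<^sup>2) * ((- 1 / 2) * (fr x \<bullet> K))"
      if x: "of_real x \<in> \<Omega>" for x
    proof -
      \<comment> \<open>\<open>?m\<close> is the value of b \<rho>; the second equation divided by a
        has the form that \<open>solve_rotation\<close> takes.\<close>
      let ?N = "(s x)\<^sup>2 + (t x)\<^sup>2" and ?m = "(b * ((1 / a) * (fr x \<bullet> I)))"
      have "?N * ?m = ((s x)\<^sup>2 - (t x)\<^sup>2) * (fr x \<bullet> J) - 2 * s x * t x * (fr x \<bullet> K)"
        using e(2)[OF x] ab(2) by (simp add: field_simps)
      from solve_rotation[OF e(1)[OF x] this]
      show "?m * ((s x)\<^sup>2 - (t x)\<^sup>2) = ?N * (fr x \<bullet> J)"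
        "?m * s x * t x = ?N * ((- 1 / 2) * (fr x \<bullet> K))" .
    qed
    have q1: "is_slice_quot \<Omega> (\<lambda>q. b *\<^sub>R \<rho> q * ((h0 q)\<^sup>2 - (h1 q)\<^sup>2)) hs v2"
    proof (rule slice_quotI[OF hs slice_preserving_mult[OF b\<rho> sq_diff] v2(1)])
      fix x assume x: "of_real x \<in> \<Omega>"
      from arg_cong[OF key(1)[OF x], of "of_real :: real \<Rightarrow> quat"]
      show "b *\<^sub>R \<rho> (of_real x) * ((h0 (of_real x))\<^sup>2 - (h1 (of_real x))\<^sup>2) = hs (of_real x) * v2 (of_real x)"
        unfolding \<rho>x[OF x] real_values[OF x] v2(2)[rule_format, OF x] scaleR_conv_of_real
        by (simp only: of_real_mult of_real_diff of_real_power)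
    qed
    have q2: "is_slice_quot \<Omega> (\<lambda>q. b *\<^sub>R \<rho> q * h0 q * h1 q) hs (\<lambda>q. (- 1 / 2) *\<^sub>R v3 q)"
    proof (rule slice_quotI[OF hs slice_preserving_mult[OF slice_preserving_mult[OF b\<rho> h0] h1]
          slice_preserving_scaleR[OF v3(1)]])
      fix x assume x: "of_real x \<in> \<Omega>"
      from arg_cong[OF key(2)[OF x], of "of_real :: real \<Rightarrow> quat"]
      show "b *\<^sub>R \<rho> (of_real x) * h0 (of_real x) * h1 (of_real x) =
          hs (of_real x) * ((- 1 / 2) *\<^sub>R v3 (of_real x))"
        unfolding \<rho>x[OF x] real_values[OF x] v3(2)[rule_format, OF x] scaleR_conv_of_real
        by (simp only: of_real_mult of_real_diff of_real_power)
    qed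
    \<comment> \<open>The divisibility conditions concern \<rho>, the quotients in the formula b
      \<rho>; the nonzero b is divided out.\<close>
    have d1: "is_slice_quot \<Omega> (\<lambda>q. \<rho> q * ((h0 q)\<^sup>2 - (h1 q)\<^sup>2)) hs (\<lambda>q. (1 / b) *\<^sub>R v2 q)"
      unfolding is_slice_quot_def
    proof (intro conjI ballI slice_preserving_scaleR v2(1))
      fix q assume "q \<in> \<Omega>"
      then have "b *\<^sub>R \<rho> q * ((h0 q)\<^sup>2 - (h1 q)\<^sup>2) = hs q * v2 q" using q1 by (simp add: is_slice_quot_def)
      then have "(1 / b) *\<^sub>R (b *\<^sub>R \<rho> q * ((h0 q)\<^sup>2 - (h1 q)\<^sup>2)) = hs q * ((1 / b) *\<^sub>R v2 q)" by simp
      then show "\<rho> q * ((h0 q)\<^sup>2 - (h1 q)\<^sup>2) = hs q * ((1 / b) *\<^sub>R v2 q)" using ab(3) by simp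
    qed
    have d2: "is_slice_quot \<Omega> (\<lambda>q. h0 q * h1 q * \<rho> q) hs (\<lambda>q. (1 / b) *\<^sub>R (- 1 / 2) *\<^sub>R v3 q)"
    proof (rule slice_quotI[OF hs slice_preserving_mult[OF slice_preserving_mult[OF h0 h1] \<rho>]
          slice_preserving_scaleR[OF slice_preserving_scaleR[OF v3(1)]]])
      fix x assume x: "of_real x \<in> \<Omega>"
      have "s x * t x * ((1 / a) * (fr x \<bullet> I)) = (1 / b) * ((b * ((1 / a) * (fr x \<bullet> I))) * s x * t x)"
        using ab(3) by simp
      also have "\<dots> = ((s x)\<^sup>2 + (t x)\<^sup>2) * ((1 / b) * ((- 1 / 2) * (fr x \<bullet> K)))"
        unfolding key(2)[OF x] by simp
      finally show "h0 (of_real x) * h1 (of_real x) * \<rho> (of_real x) =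
          hs (of_real x) * ((1 / b) *\<^sub>R (- 1 / 2) *\<^sub>R v3 (of_real x))"
        unfolding \<rho>x[OF x] real_values[OF x] v3(2)[rule_format, OF x] scaleR_conv_of_real
          of_real_mult[symmetric] by (simp only:)
    qed
    have r: "(\<lambda>q. slice_real_part \<Omega> f q + v1 q * I + v2 q * J + v3 q * K) \<in> slice_regular \<Omega>"
      by (intro slice_regular_add slice_regular_mult_const slice_preserving_regular fr0(1) v1(1) v2(1) v3(1))
    have "fr x = slice_real_part \<Omega> f (of_real x) + v1 (of_real x) * I + v2 (of_real x) * J + v3 (of_real x) * K"
      if x: "of_real x \<in> \<Omega>" for x
      using expand[of "fr x"]
      unfolding fr0(2)[OF x] v1(2)[rule_format, OF x] v2(2)[rule_format, OF x] v3(2)[rule_format, OF x]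
      by (simp add: scaleR_conv_of_real)
    then have feq: "f q = slice_real_part \<Omega> f q + v1 q * I + v2 q * J + v3 q * K" if "q \<in> \<Omega>" for q
      using slice_regular_eqI[OF dom f r _ that] by blast
    show ?R
    proof (intro bexI[OF _ \<rho>] conjI ballI)
      fix q assume q: "q \<in> \<Omega>"
      have m: "2 * ((- 1 / 2) *\<^sub>R v) = - v" for v :: quat
        unfolding mult_2 scaleR_left_distrib[symmetric] by simp
      show "f q = f0 q
         + a *\<^sub>R \<rho> q * I
         + slice_quot \<Omega> (\<lambda>q. b *\<^sub>R \<rho> q * ((h0 q)\<^sup>2 - (h1 q)\<^sup>2)) hs q * J
         - 2 * slice_quot \<Omega> (\<lambda>q. b *\<^sub>R \<rho> q * h0 q * h1 q) hs q * K"
        unfolding slice_quot_unique[OF q1 q] slice_quot_unique[OF q2 q] f0[rule_format, OF q] m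
        using feq[OF q] ab(2) by (simp add: \<rho>_def)
    qed (use d1 d2 in \<open>auto simp: slice_dvd_def\<close>)
  next
    assume ?R
    then obtain \<rho> k1 k2 where \<rho>: "\<rho> \<in> slice_preserving \<Omega>"
      and q1: "is_slice_quot \<Omega> (\<lambda>q. \<rho> q * ((h0 q)\<^sup>2 - (h1 q)\<^sup>2)) hs k1"
      and q2: "is_slice_quot \<Omega> (\<lambda>q. h0 q * h1 q * \<rho> q) hs k2"
      and feq: "\<And>q. q \<in> \<Omega> \<Longrightarrow> f q = f0 q
         + a *\<^sub>R \<rho> q * I
         + slice_quot \<Omega> (\<lambda>q. b *\<^sub>R \<rho> q * ((h0 q)\<^sup>2 - (h1 q)\<^sup>2)) hs q * J
         - 2 * slice_quot \<Omega> (\<lambda>q. b *\<^sub>R \<rho> q * h0 q * h1 q) hs q * K"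
      unfolding slice_dvd_def by blast
    have k1: "k1 \<in> slice_preserving \<Omega>" and k2: "k2 \<in> slice_preserving \<Omega>"
      using q1 q2 by (simp_all add: is_slice_quot_def)
    have b\<rho>: "(\<lambda>q. b *\<^sub>R \<rho> q) \<in> slice_preserving \<Omega>" by (rule slice_preserving_scaleR[OF \<rho>])
    have e: "\<exists>r c1 c2. \<rho> (of_real x) = of_real r \<and> k1 (of_real x) = of_real c1 \<and> k2 (of_real x) = of_real c2 \<and>
      r * ((s x)\<^sup>2 - (t x)\<^sup>2) = ((s x)\<^sup>2 + (t x)\<^sup>2) * c1 \<and>
      r * s x * t x = ((s x)\<^sup>2 + (t x)\<^sup>2) * c2" if x: "of_real x \<in> \<Omega>" for x
    proof -
      obtain r where r: "\<rho> (of_real x) = of_real r" using slice_preserving_of_real[OF \<rho> x] by blast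
      obtain c1 where c1: "k1 (of_real x) = of_real c1" using slice_preserving_of_real[OF k1 x] by blast
      obtain c2 where c2: "k2 (of_real x) = of_real c2" using slice_preserving_of_real[OF k2 x] by blast
      have "\<rho> (of_real x) * ((h0 (of_real x))\<^sup>2 - (h1 (of_real x))\<^sup>2) = hs (of_real x) * k1 (of_real x)"
        using q1 x unfolding is_slice_quot_def by blast
      then have "(of_real (r * ((s x)\<^sup>2 - (t x)\<^sup>2)) :: quat) = of_real (((s x)\<^sup>2 + (t x)\<^sup>2) * c1)"
        unfolding r c1 real_values[OF x] by (simp only: of_real_mult of_real_diff of_real_power)
      then have e1: "r * ((s x)\<^sup>2 - (t x)\<^sup>2) = ((s x)\<^sup>2 + (t x)\<^sup>2) * c1" by (simp only: of_real_eq_iff)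
      have "h0 (of_real x) * h1 (of_real x) * \<rho> (of_real x) = hs (of_real x) * k2 (of_real x)"
        using q2 x unfolding is_slice_quot_def by blast
      then have "(of_real (s x * t x * r) :: quat) = of_real (((s x)\<^sup>2 + (t x)\<^sup>2) * c2)"
        unfolding r c2 real_values[OF x] by (simp only: of_real_mult)
      then have "s x * t x * r = ((s x)\<^sup>2 + (t x)\<^sup>2) * c2" by (simp only: of_real_eq_iff)
      then have "r * s x * t x = ((s x)\<^sup>2 + (t x)\<^sup>2) * c2" by (simp add: mult_ac)
      with r c1 c2 e1 show ?thesis by blast
    qed
    \<comment> \<open>Conversely, by uniqueness the quotients in the formula are b times those
      supplied by divisibility.\<close>
    have bq1: "is_slice_quot \<Omega> (\<lambda>q. b *\<^sub>R \<rho> q * ((h0 q)\<^sup>2 - (h1 q)\<^sup>2)) hs (\<lambda>q. b *\<^sub>R k1 q)"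
      using q1 slice_preserving_scaleR[OF k1] by (simp add: is_slice_quot_def)
    have bq2: "is_slice_quot \<Omega> (\<lambda>q. b *\<^sub>R \<rho> q * h0 q * h1 q) hs (\<lambda>q. b *\<^sub>R k2 q)"
    proof (rule slice_quotI[OF hs slice_preserving_mult[OF slice_preserving_mult[OF b\<rho> h0] h1]
          slice_preserving_scaleR[OF k2]])
      fix x assume x: "of_real x \<in> \<Omega>"
      obtain r c2 where r: "\<rho> (of_real x) = of_real r" "k2 (of_real x) = of_real c2"
        "r * s x * t x = ((s x)\<^sup>2 + (t x)\<^sup>2) * c2" using e[OF x] by blast
      have "(of_real (b * r * s x * t x) :: quat) = of_real (((s x)\<^sup>2 + (t x)\<^sup>2) * (b * c2))"
        using r(3) by (simp only: of_real_eq_iff) algebra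
      then show "b *\<^sub>R \<rho> (of_real x) * h0 (of_real x) * h1 (of_real x) = hs (of_real x) * b *\<^sub>R k2 (of_real x)"
        unfolding r real_values[OF x] scaleR_conv_of_real by (simp only: of_real_mult)
    qed
    show "hfh \<in> slice_regular_on \<Omega> (a *\<^sub>R I + b *\<^sub>R J)"
      unfolding iff
    proof (intro allI impI)
      fix x assume x: "of_real x \<in> \<Omega>"
      obtain r c1 c2 where r: "\<rho> (of_real x) = of_real r" and c1: "k1 (of_real x) = of_real c1"
        and c2: "k2 (of_real x) = of_real c2"
        and e1: "r * ((s x)\<^sup>2 - (t x)\<^sup>2) = ((s x)\<^sup>2 + (t x)\<^sup>2) * c1"
        and e2: "r * s x * t x = ((s x)\<^sup>2 + (t x)\<^sup>2) * c2" using e[OF x] by blast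
      have "fr x = of_real (qre (fr x)) + a *\<^sub>R of_real r * I + b *\<^sub>R of_real c1 * J - 2 * b *\<^sub>R of_real c2 * K"
        using feq[OF x] unfolding slice_quot_unique[OF bq1 x] slice_quot_unique[OF bq2 x] f0[rule_format, OF x]
          fr0(2)[OF x] r c1 c2 .
      also have "\<dots> = of_real (qre (fr x)) + (a * r) *\<^sub>R I + (b * c1) *\<^sub>R J + (- 2 * b * c2) *\<^sub>R K"
        by (simp add: scaleR_conv_of_real mult.assoc)
      finally have v: "fr x \<bullet> I = a * r" "fr x \<bullet> J = b * c1" "fr x \<bullet> K = - 2 * b * c2"
        using inner_frame_combination by metis+
      show "2 * s x * t x * (fr x \<bullet> J) + ((s x)\<^sup>2 - (t x)\<^sup>2) * (fr x \<bullet> K) = 0 \<and>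
        a * (((s x)\<^sup>2 - (t x)\<^sup>2) * (fr x \<bullet> J) - 2 * s x * t x * (fr x \<bullet> K)) =
          b * (((s x)\<^sup>2 + (t x)\<^sup>2) * (fr x \<bullet> I))"
      \<comment> \<open>At real zeros of \<open>hs\<close> both equations are trivial. Elsewhere
        they are checked after multiplication by s^2 + t^2, so that \<open>e1\<close> and
        \<open>e2\<close> eliminate c1 and c2.\<close>
      proof (cases "(s x)\<^sup>2 + (t x)\<^sup>2 = 0")
        case True
        then show ?thesis by (simp add: sum_power2_eq_zero_iff)
      next
        case False
        let ?N = "(s x)\<^sup>2 + (t x)\<^sup>2"
        have "?N * (2 * s x * t x * (b * c1) + ((s x)\<^sup>2 - (t x)\<^sup>2) * (- 2 * b * c2)) = ?N * 0"
          "?N * (a * (((s x)\<^sup>2 - (t x)\<^sup>2) * (b * c1) - 2 * s x * t x * (- 2 * b * c2))) =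
            ?N * (b * (?N * (a * r)))"
          using e1 e2 by algebra+
        then show ?thesis unfolding v using False by (metis mult_left_cancel)
      qed
    qed
  qed
qed

end

section \<open>The three relative positions of \<open>I0\<close> and \<open>M0\<close>\<close>

theorem theorem5p6:
  fixes \<Omega> :: "quat set" and I0 M0 :: quat and h h0 h1 f f0 :: "quat \<Rightarrow> quat"
  assumes "symmetric_slice_domain \<Omega>"
    and "I0 \<in> imag_units"
    and "h \<in> slice_regular_on \<Omega> I0 - slice_preserving \<Omega>"
    and "h0 \<in> slice_preserving \<Omega>" and "h1 \<in> slice_preserving \<Omega>"
    and "\<forall>q\<in>\<Omega>. h q = h0 q + h1 q * I0"
    and "f \<in> slice_regular \<Omega> - slice_regular_on \<Omega> I0"
    and "\<forall>q\<in>\<Omega>. f0 q = slice_real_part \<Omega> f q"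
    and "M0 \<in> imag_units"
  shows "star_prod \<Omega> (star_prod \<Omega> h f) (regular_conj \<Omega> h) \<in> slice_regular_on \<Omega> M0 \<longleftrightarrow>
    (I0 \<bullet> M0 = 0 \<and>
      (let K0 = I0 * M0; hs2 = (\<lambda>q. (symmetrized \<Omega> h q)\<^sup>2) in
        \<exists>\<rho>\<in>slice_preserving \<Omega>.
          slice_dvd \<Omega> hs2 (\<lambda>q. \<rho> q * ((h0 q)\<^sup>2 - (h1 q)\<^sup>2)) \<and>
          slice_dvd \<Omega> hs2 (\<lambda>q. \<rho> q * h0 q * h1 q) \<and>
          (\<forall>q\<in>\<Omega>. f q = f0 q
             + slice_quot \<Omega> (\<lambda>q. \<rho> q * ((h0 q)\<^sup>2 - (h1 q)\<^sup>2)) hs2 q * M0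
             - 2 * slice_quot \<Omega> (\<lambda>q. \<rho> q * h0 q * h1 q) hs2 q * K0)))
    \<or>
    (slice_plane I0 \<noteq> slice_plane M0 \<and> I0 \<bullet> M0 \<noteq> 0 \<and>
      (let K0 = quat_wedge I0 M0 /\<^sub>R norm (quat_wedge I0 M0);
           J0 = K0 * I0;
           hs = symmetrized \<Omega> h in
        \<exists>a b :: real. b > 0 \<and> a\<^sup>2 + b\<^sup>2 = 1 \<and> M0 = a *\<^sub>R I0 + b *\<^sub>R J0 \<and>
          (\<exists>\<rho>\<in>slice_preserving \<Omega>.
            slice_dvd \<Omega> hs (\<lambda>q. \<rho> q * ((h0 q)\<^sup>2 - (h1 q)\<^sup>2)) \<and>
            slice_dvd \<Omega> hs (\<lambda>q. h0 q * h1 q * \<rho> q) \<and>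
            (\<forall>q\<in>\<Omega>. f q = f0 q
               + a *\<^sub>R \<rho> q * I0
               + slice_quot \<Omega> (\<lambda>q. b *\<^sub>R \<rho> q * ((h0 q)\<^sup>2 - (h1 q)\<^sup>2)) hs q * J0
               - 2 * slice_quot \<Omega> (\<lambda>q. b *\<^sub>R \<rho> q * h0 q * h1 q) hs q * K0))))"
    (is "?L \<longleftrightarrow> ?R1 \<or> ?R2")
proof -
  have frame: "conjugation_frame I0 J K \<Omega> h h0 h1 f" if "quat_frame I0 J K" for J K
    unfolding conjugation_frame_def conjugation_frame_axioms_def
    using that assms by (auto simp: slice_regular_on_def)
  consider (orth) "I0 \<bullet> M0 = 0" | (par) "I0 \<bullet> M0 \<noteq> 0" "slice_plane I0 = slice_plane M0"
    | (obl) "I0 \<bullet> M0 \<noteq> 0" "slice_plane I0 \<noteq> slice_plane M0" by blast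
  then show ?thesis
  proof cases
    case orth
    then have "quat_frame I0 M0 (I0 * M0)" using assms(2,9) by unfold_locales simp_all
    then interpret conjugation_frame I0 M0 "I0 * M0" \<Omega> h h0 h1 f by (rule frame)
    show ?thesis using orthogonal_iff[OF assms(8)] orth by (simp add: Let_def)
  next
    case par
    \<comment> \<open>M0 supplies no second direction, so any J orthogonal to I0 serves. Both
      alternatives on the right are false, and it remains to refute the left side.\<close>
    obtain J where "quat_frame I0 J (I0 * J)" by (rule quat_frame_exists[OF assms(2)])
    then interpret conjugation_frame I0 J "I0 * J" \<Omega> h h0 h1 f by (rule frame)
    obtain a where "a\<^sup>2 = 1" "M0 = a *\<^sub>R I0" by (rule slice_plane_eqD[OF assms(2,9) par(2)])
    then have "\<not> ?L" using parallel[of a] assms(7) by blast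
    then show ?thesis using par by blast
  next
    case obl
    define K where "K = quat_wedge I0 M0 /\<^sub>R norm (quat_wedge I0 M0)"
    note w = quat_wedge_frame[OF assms(2,9) obl(2), folded K_def]
    interpret conjugation_frame I0 "K * I0" K \<Omega> h h0 h1 f by (rule frame[OF w(1)])
    {
      \<comment> \<open>Any a and b admissible in (ii) satisfy a = I0 \<bullet> M0, which is nonzero
        here, so \<open>oblique_iff\<close> applies. This covers the arbitrary pair of the backward
        direction as well as the inner product and the norm of the wedge, the witnesses of the
        forward one.\<close>
      fix a b :: real
      assume M0: "M0 = a *\<^sub>R I0 + b *\<^sub>R (K * I0)" and b: "b > 0" and sq: "a\<^sup>2 + b\<^sup>2 = 1"
      have "I0 \<bullet> M0 = a" unfolding M0 by (simp add: inner_add_right inner_frame)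
      then have "a \<noteq> 0" "b \<noteq> 0" using obl(1) b by simp_all
      note oblique_iff[OF assms(8) sq this, folded M0]
    }
    note e = this
    have "?L \<Longrightarrow> ?R2"
      unfolding Let_def K_def[symmetric]
      by (intro conjI obl, rule exI[of _ "I0 \<bullet> M0"], rule exI[of _ "norm (quat_wedge I0 M0)"],
          intro conjI w(2-4)) (rule e[OF w(4,2,3), THEN iffD1])
    moreover have "?R2 \<Longrightarrow> ?L"
      unfolding Let_def K_def[symmetric]
      by (elim conjE exE) (rule e[THEN iffD2])
    moreover have "\<not> ?R1" using obl(1) by blast
    ultimately show ?thesis by blast
  qed
qed

end
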